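(* There is an algorithm that, given a DFA $M$ with $n$ states over an alphabet $\Sigma$, decides in $O(n^2)$ time whether $L = L(M)$ is almost prefix-free; likewise for almost suffix-free, almost factor-free, and almost subword-free.
   Context: Let $\unlhd$ be one of the relations on $\Sigma^*$: prefix ($v \unlhd w$ iff $w = vx$ for some $x$), suffix ($w = xv$), factor ($w = xvy$), or subword ($v$ is a not-necessarily-contiguous subsequence of $w$). A witness to the failure of $\unlhd$-freeness of $L$ is a pair $(v,w)$ with $v, w \in L$, $v \unlhd w$ and $v \neq w$. $L$ is $\unlhd$-free if no such witness exists, and almost $\unlhd$-free if there exists at least one, but only finitely many, such witnesses. The alphabet $\Sigma$ is regarded as fixed in the running-time bound. *)

theory Defs
  imports Main "HOL-Library.Sublist"
begin

definition witnesses :: "('a list \<Rightarrow> 'a list \<Rightarrow> bool) \<Rightarrow> 'a list set \<Rightarrow> ('a list \<times> 'a list) set" where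
  "witnesses R L = {(v, w). v \<in> L \<and> w \<in> L \<and> R v w \<and> v \<noteq> w}"

definition almost_free :: "('a list \<Rightarrow> 'a list \<Rightarrow> bool) \<Rightarrow> 'a list set \<Rightarrow> bool" where
  "almost_free R L \<longleftrightarrow> witnesses R L \<noteq> {} \<and> finite (witnesses R L)"

text \<open>
  A DFA is presented to an algorithm with its states numbered \<open>0, \<dots>, n - 1\<close> and its letters
  numbered \<open>0, \<dots>, k - 1\<close>. The values of \<open>trans\<close> outside these ranges are irrelevant.
\<close>

record dfa =
  num_states :: nat
  num_letters :: nat
  trans :: "nat \<Rightarrow> nat \<Rightarrow> nat"
  start :: nat
  accepting :: "nat set"

definition wf_dfa :: "dfa \<Rightarrow> bool" where
  "wf_dfa M \<longleftrightarrow>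
     start M < num_states M \<and>
     accepting M \<subseteq> {..<num_states M} \<and>
     (\<forall>q<num_states M. \<forall>a<num_letters M. trans M q a < num_states M)"

definition dfa_lang :: "dfa \<Rightarrow> nat list set" where
  "dfa_lang M = {w \<in> lists {..<num_letters M}. foldl (trans M) (start M) w \<in> accepting M}"

text \<open>
  The machine model is a random access machine with words of bounded length. A program is a
  structured three-address program over registers and a random access memory, all holding natural
  numbers. Every elementary instruction and every test costs one time unit. The parameter \<open>W\<close> of
  the semantics is the largest number that fits into a word: an instruction whose result would
  exceed \<open>W\<close> has no execution, so that large numbers cannot be used to save time. Addition and
  truncated subtraction are the only arithmetic.
\<close>

datatype com =
    Skip
  | Const nat nat            \<comment> \<open>\<open>r\<^sub>x := i\<close>\<close>
  | Add nat nat nat          \<comment> \<open>\<open>r\<^sub>x := r\<^sub>y + r\<^sub>z\<close>\<close>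
  | Sub nat nat nat          \<comment> \<open>\<open>r\<^sub>x := r\<^sub>y - r\<^sub>z\<close>\<close>
  | Load nat nat             \<comment> \<open>\<open>r\<^sub>x := mem[r\<^sub>y]\<close>\<close>
  | Store nat nat            \<comment> \<open>\<open>mem[r\<^sub>x] := r\<^sub>y\<close>\<close>
  | Seq com com
  | IfLess nat nat com com   \<comment> \<open>if \<open>r\<^sub>x < r\<^sub>y\<close>\<close>
  | WhileLess nat nat com    \<comment> \<open>while \<open>r\<^sub>x < r\<^sub>y\<close>\<close>

type_synonym config = "(nat \<Rightarrow> nat) \<times> (nat \<Rightarrow> nat)"

text \<open>\<open>exec W c s t s'\<close>: started in configuration \<open>s\<close> (registers, memory), the program \<open>c\<close> halts in
  \<open>s'\<close> after exactly \<open>t\<close> time units.\<close>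

inductive exec :: "nat \<Rightarrow> com \<Rightarrow> config \<Rightarrow> nat \<Rightarrow> config \<Rightarrow> bool" for W :: nat where
  Skip: "exec W Skip s 1 s"
| Const: "i \<le> W \<Longrightarrow> exec W (Const x i) (r, m) 1 (r(x := i), m)"
| Add: "r y + r z \<le> W \<Longrightarrow> exec W (Add x y z) (r, m) 1 (r(x := r y + r z), m)"
| Sub: "exec W (Sub x y z) (r, m) 1 (r(x := r y - r z), m)"
| Load: "exec W (Load x y) (r, m) 1 (r(x := m (r y)), m)"
| Store: "exec W (Store x y) (r, m) 1 (r, m(r x := r y))"
| Seq: "exec W c\<^sub>1 s t\<^sub>1 s' \<Longrightarrow> exec W c\<^sub>2 s' t\<^sub>2 s'' \<Longrightarrow> exec W (Seq c\<^sub>1 c\<^sub>2) s (t\<^sub>1 + t\<^sub>2) s''"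
| IfTrue: "fst s x < fst s y \<Longrightarrow> exec W c\<^sub>1 s t s' \<Longrightarrow> exec W (IfLess x y c\<^sub>1 c\<^sub>2) s (1 + t) s'"
| IfFalse: "\<not> fst s x < fst s y \<Longrightarrow> exec W c\<^sub>2 s t s' \<Longrightarrow> exec W (IfLess x y c\<^sub>1 c\<^sub>2) s (1 + t) s'"
| WhileFalse: "\<not> fst s x < fst s y \<Longrightarrow> exec W (WhileLess x y c) s 1 s"
| WhileTrue: "fst s x < fst s y \<Longrightarrow> exec W c s t\<^sub>1 s' \<Longrightarrow> exec W (WhileLess x y c) s' t\<^sub>2 s'' \<Longrightarrow>
    exec W (WhileLess x y c) s (1 + t\<^sub>1 + t\<^sub>2) s''"

inductive_cases exec_elims:
  "exec W Skip s t s'" "exec W (Const x i) s t s'" "exec W (Add x y z) s t s'"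
  "exec W (Sub x y z) s t s'" "exec W (Load x y) s t s'" "exec W (Store x y) s t s'"
  "exec W (Seq c\<^sub>1 c\<^sub>2) s t s'" "exec W (IfLess x y c\<^sub>1 c\<^sub>2) s t s'" "exec W (WhileLess x y c) s t s'"

lemma exec_deterministic:
  "exec W c s t s' \<Longrightarrow> exec W c s u s'' \<Longrightarrow> t = u \<and> s' = s''"
proof (induction arbitrary: u s'' rule: exec.induct)
  case (Seq c\<^sub>1 s t\<^sub>1 s' c\<^sub>2 t\<^sub>2 s2)
  from Seq.prems show ?case by (rule exec_elims) (metis Seq.IH)
next
  case (IfTrue s x y c\<^sub>1 t s' c\<^sub>2)
  from IfTrue.prems show ?case by (rule exec_elims) (metis IfTrue.IH plus_1_eq_Suc, metis IfTrue.hyps(1))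
next
  case (IfFalse s x y c\<^sub>2 t s' c\<^sub>1)
  from IfFalse.prems show ?case by (rule exec_elims) (metis IfFalse.hyps(1), metis IfFalse.IH plus_1_eq_Suc)
next
  case (WhileFalse s x y c)
  from WhileFalse.prems show ?case by (rule exec_elims) (simp, metis WhileFalse.hyps(1))
next
  case (WhileTrue s x y c t\<^sub>1 s' t\<^sub>2 s2)
  from WhileTrue.prems show ?case by (rule exec_elims) (metis WhileTrue.hyps(1), metis WhileTrue.IH plus_1_eq_Suc add_Suc)
qed (erule exec_elims, simp)+

text \<open>
  The input is \<open>n, k\<close>, the start state, the characteristic vector of the accepting states, and the
  transition table row by row.
\<close>

definition encode_dfa :: "dfa \<Rightarrow> nat list" where
  "encode_dfa M =
     [num_states M, num_letters M, start M] @
     [if q \<in> accepting M then 1 else 0. q \<leftarrow> [0..<num_states M]] @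
     [trans M q a. q \<leftarrow> [0..<num_states M], a \<leftarrow> [0..<num_letters M]]"

definition initial_config :: "nat list \<Rightarrow> config" where
  "initial_config xs = (\<lambda>_. 0, \<lambda>i. if i < length xs then xs ! i else 0)"

text \<open>The answer is left in register \<open>0\<close>.\<close>

definition answers_within :: "nat \<Rightarrow> com \<Rightarrow> nat list \<Rightarrow> nat \<Rightarrow> bool \<Rightarrow> bool" where
  "answers_within W P xs T b \<longleftrightarrow>
     (\<exists>t s. exec W P (initial_config xs) t s \<and> t \<le> T \<and> fst s 0 = (if b then 1 else 0))"

text \<open>
  One program serves all DFAs over all alphabets. For a fixed alphabet size \<open>k\<close> it runs in time
  \<open>c * n\<^sup>2\<close>, on words that hold the numbers up to \<open>c * n ^ d\<close>, that is, words of \<open>O(log n)\<close> bits.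
  (A DFA has a start state, hence \<open>n \<ge> 1\<close>.)
\<close>

definition decidable_in_quadratic_time :: "(dfa \<Rightarrow> bool) \<Rightarrow> bool" where
  "decidable_in_quadratic_time Q \<longleftrightarrow>
     (\<exists>P. \<forall>k. \<exists>c d. \<forall>M. wf_dfa M \<and> num_letters M = k \<longrightarrow>
        answers_within (c * num_states M ^ d) P (encode_dfa M) (c * (num_states M)\<^sup>2) (Q M))"

end

theory Submission
  imports Defs
begin

text \<open>
  A pair \<open>v \<unlhd> w\<close>, \<open>v \<noteq> w\<close> is described by an alignment: a word whose letters are either read in both \<open>v\<close> and \<open>w\<close> or
  only in \<open>w\<close>. For each of the four relations the admissible patterns of these two kinds of letters form a regular
  language recognised by a control automaton with at most six states. Running it together with two copies
  of the DFA, one for \<open>v\<close> and one for \<open>w\<close>, gives a deterministic automaton with \<open>6 n\<^sup>2\<close> states and \<open>2 k\<close> letters whose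
  language maps onto the set of witnesses with finite fibres. Hence \<open>L\<close> is almost \<open>\<unlhd>\<close>-free iff this
  language is nonempty and finite.

  Both properties are read off least sets of states closed under a counting rule, which a worklist over the
  reversed edges computes in linear time: the states with nonempty language form the least set containing
  the accepting states and every state with at least one edge into the set; the states with finite
  language form the least set containing the states with empty language and every state all of whose \<open>2 k\<close>
  edges lead into the set.
\<close>

section \<open>Weakest preconditions with a clock\<close>

text \<open>A pair can have several alignments, so the product automaton counts alignments rather
  than pairs. This is harmless: an alignment of \<open>(v, w)\<close> is as long as
  \<open>w\<close>, so a pair has only finitely many, and no canonical choice has to be built into
  the control. Finiteness is usually tested by looking for a cycle among useful states. The least
  set used here avoids depth-first search: a node outside it has a nonempty language and a successor
  outside it, hence accepts arbitrarily long words. Since both closures run backwards, reachability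
  from the start never has to be computed; only the membership of the start node is read off. Both
  closures are one program, run with threshold 1 and then with \<open>2 * k\<close>. The alphabet
  with \<open>k = 0\<close> must be split off, because the second threshold would be 0. For fixed
  \<open>k\<close> there are 6 n^2 nodes and 12 k n^2 edges, each handled in bounded time, and all
  addresses are O(n^2). As the machine only adds and subtracts, the products \<open>p * n\<close>
  needed for addresses are tabulated beforehand.\<close>

text \<open>The argument \<open>u\<close> is a clock: it counts the time units used so far.\<close>

definition wp :: "nat \<Rightarrow> com \<Rightarrow> ((nat \<Rightarrow> nat) \<Rightarrow> (nat \<Rightarrow> nat) \<Rightarrow> nat \<Rightarrow> bool) \<Rightarrow>
    (nat \<Rightarrow> nat) \<Rightarrow> (nat \<Rightarrow> nat) \<Rightarrow> nat \<Rightarrow> bool" where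
  "wp W c Q r m u \<longleftrightarrow> (\<exists>t r' m'. exec W c (r, m) t (r', m') \<and> Q r' m' (u + t))"

lemma wp_Skip: "wp W Skip Q r m u \<longleftrightarrow> Q r m (u + 1)"
  unfolding wp_def by (safe elim!: exec_elims; (simp; fail | blast intro: exec.Skip))

lemma wp_Const: "wp W (Const x i) Q r m u \<longleftrightarrow> i \<le> W \<and> Q (r(x := i)) m (u + 1)"
  unfolding wp_def by (safe elim!: exec_elims; (simp; fail | blast intro: exec.Const))

lemma wp_Add: "wp W (Add x y z) Q r m u \<longleftrightarrow> r y + r z \<le> W \<and> Q (r(x := r y + r z)) m (u + 1)"
  unfolding wp_def by (safe elim!: exec_elims; (simp; fail | blast intro: exec.Add))

lemma wp_Sub: "wp W (Sub x y z) Q r m u \<longleftrightarrow> Q (r(x := r y - r z)) m (u + 1)"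
  unfolding wp_def by (safe elim!: exec_elims; (simp; fail | blast intro: exec.Sub))

lemma wp_Load: "wp W (Load x y) Q r m u \<longleftrightarrow> Q (r(x := m (r y))) m (u + 1)"
  unfolding wp_def by (safe elim!: exec_elims; (simp; fail | blast intro: exec.Load))

lemma wp_Store: "wp W (Store x y) Q r m u \<longleftrightarrow> Q r (m(r x := r y)) (u + 1)"
  unfolding wp_def by (safe elim!: exec_elims; (simp; fail | blast intro: exec.Store))

lemma wp_Seq: "wp W (Seq c d) Q r m u \<longleftrightarrow> wp W c (wp W d Q) r m u"
proof
  assume "wp W (Seq c d) Q r m u"
  then obtain t r' m' where "exec W (Seq c d) (r, m) t (r', m')" "Q r' m' (u + t)"
    unfolding wp_def by blast
  then show "wp W c (wp W d Q) r m u"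
    unfolding wp_def by (auto elim!: exec_elims simp: add.assoc) blast
next
  assume "wp W c (wp W d Q) r m u"
  then show "wp W (Seq c d) Q r m u"
    unfolding wp_def by (metis exec.Seq add.assoc)
qed

lemma wp_If: "wp W (IfLess x y c d) Q r m u \<longleftrightarrow>
    (if r x < r y then wp W c Q r m (u + 1) else wp W d Q r m (u + 1))"
proof
  assume "wp W (IfLess x y c d) Q r m u"
  then obtain t r' m' where e: "exec W (IfLess x y c d) (r, m) t (r', m')" and q: "Q r' m' (u + t)"
    unfolding wp_def by blast
  from e show "if r x < r y then wp W c Q r m (u + 1) else wp W d Q r m (u + 1)"
    by (rule exec_elims) (use q in \<open>auto simp: wp_def add.assoc\<close>)
next
  assume "if r x < r y then wp W c Q r m (u + 1) else wp W d Q r m (u + 1)"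
  then show "wp W (IfLess x y c d) Q r m u"
    unfolding wp_def add.assoc by (metis exec.IfTrue exec.IfFalse fst_conv)
qed

section \<open>Loop rules\<close>

lemma wp_While_False: "\<not> r x < r y \<Longrightarrow> Q r m (u + 1) \<Longrightarrow> wp W (WhileLess x y c) Q r m u"
  unfolding wp_def by (metis exec.WhileFalse fst_conv)

lemma wp_While_True:
  assumes "r x < r y" "wp W c (wp W (WhileLess x y c) Q) r m (u + 1)"
  shows "wp W (WhileLess x y c) Q r m u"
proof -
  obtain t r' m' t' r'' m'' where e: "exec W c (r, m) t (r', m')"
    "exec W (WhileLess x y c) (r', m') t' (r'', m'')" "Q r'' m'' (u + 1 + t + t')"
    using assms(2) unfolding wp_def by blast
  have "exec W (WhileLess x y c) (r, m) (1 + t + t') (r'', m'')"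
    by (rule exec.WhileTrue) (use assms(1) e in auto)
  then show ?thesis
    using e(3) unfolding wp_def by (metis add.assoc)
qed

lemma wp_conseq:
  assumes "wp W c Q r m u" "\<And>r m u. Q r m u \<Longrightarrow> Q' r m u"
  shows "wp W c Q' r m u"
  using assms unfolding wp_def by blast

text \<open>As \<open>wp\<close> asserts that a halting run exists, the rule has to prove
  termination: \<open>j\<close> is a variant that every iteration must decrease. Time bounds are not
  part of the rule; \<open>I\<close> carries them through the clock.\<close>

lemma wp_while:
  fixes I :: "nat \<Rightarrow> (nat \<Rightarrow> nat) \<Rightarrow> (nat \<Rightarrow> nat) \<Rightarrow> nat \<Rightarrow> bool"
  assumes "I j r m u"
    and step: "\<And>j r m u. I j r m u \<Longrightarrow> r x < r y \<Longrightarrow>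
      wp W c (\<lambda>r m u. \<exists>j'<j. I j' r m u) r m (u + 1)"
    and exit: "\<And>j r m u. I j r m u \<Longrightarrow> \<not> r x < r y \<Longrightarrow> Q r m (u + 1)"
  shows "wp W (WhileLess x y c) Q r m u"
  using assms(1)
proof (induction j arbitrary: r m u rule: less_induct)
  case (less j)
  show ?case
  proof (cases "r x < r y")
    case True
    then show ?thesis
      by (rule wp_While_True) (rule wp_conseq[OF step[OF less.prems True]], use less.IH in blast)
  next
    case False
    then show ?thesis
      using exit[OF less.prems False] by (intro wp_While_False)
  qed
qed

text \<open>The offset \<open>a\<close> allows the loop counter to be an address such as
  \<open>B + i\<close> as well as an index. The variant is \<open>n - i\<close>.\<close>

lemma wp_for:
  fixes J :: "nat \<Rightarrow> (nat \<Rightarrow> nat) \<Rightarrow> (nat \<Rightarrow> nat) \<Rightarrow> nat \<Rightarrow> bool"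
  assumes "J 0 r m u"
    and regs: "\<And>i r m u. J i r m u \<Longrightarrow> r x = a + i \<and> r y = a + n"
    and step: "\<And>i r m u. i < n \<Longrightarrow> J i r m u \<Longrightarrow> wp W c (J (Suc i)) r m (u + 1)"
    and exit: "\<And>r m u. J n r m u \<Longrightarrow> Q r m (u + 1)"
  shows "wp W (WhileLess x y c) Q r m u"
proof (rule wp_while[where I = "\<lambda>j r m u. \<exists>i\<le>n. j = n - i \<and> J i r m u"])
  show "\<exists>i\<le>n. n = n - i \<and> J i r m u"
    using assms(1) by (intro exI[of _ 0]) simp
next
  fix j r m u
  assume "\<exists>i\<le>n. j = n - i \<and> J i r m u" "r x < r y"
  then obtain i where i: "i < n" "j = n - i" "J i r m u"
    using regs by (metis nat_add_left_cancel_less)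
  show "wp W c (\<lambda>r m u. \<exists>j'<j. \<exists>i\<le>n. j' = n - i \<and> J i r m u) r m (u + 1)"
    by (rule wp_conseq[OF step[OF i(1,3)]])
       (rule exI[of _ "n - Suc i"], use i in \<open>auto intro: exI[of _ "Suc i"]\<close>)
next
  fix j r m u
  assume "\<exists>i\<le>n. j = n - i \<and> J i r m u" "\<not> r x < r y"
  then have "J n r m u"
    using regs by (metis nat_add_left_cancel_less le_neq_implies_less)
  then show "Q r m (u + 1)" by (rule exit)
qed

text \<open>Every block ends in a \<open>Skip\<close> and so costs one unit more than its entries;
  the time constants below include these units.\<close>

fun block :: "com list \<Rightarrow> com" where
  "block [] = Skip"
| "block (c # cs) = Seq c (block cs)"

lemma wp_block_Nil: "wp W (block []) Q r m u \<longleftrightarrow> Q r m (u + 1)"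
  by (simp add: wp_Skip)

lemma wp_block_Cons: "wp W (block (c # cs)) Q r m u \<longleftrightarrow> wp W c (wp W (block cs) Q) r m u"
  by (simp add: wp_Seq)

text \<open>The unapplied form also rewrites a \<open>wp W (block cs) Q\<close> that stands as a
  postcondition and has no registers, memory and clock attached.\<close>

lemma wp_block_Cons_eq: "wp W (block (c # cs)) Q = wp W c (wp W (block cs) Q)"
  by (simp add: fun_eq_iff wp_Seq)

declare block.simps [simp del]

lemmas wp_simps = wp_Skip wp_Const wp_Add wp_Sub wp_Load wp_Store wp_If wp_block_Nil wp_block_Cons

section \<open>Threshold closure\<close>

text \<open>
  \<open>l u\<close> lists the sources of the edges into \<open>u\<close>, so \<open>deg l S v\<close> is the number of edges from \<open>v\<close> into \<open>S\<close>.
\<close>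

definition deg :: "('v \<Rightarrow> 'v list) \<Rightarrow> 'v set \<Rightarrow> 'v \<Rightarrow> nat" where
  "deg l S v = (\<Sum>u\<in>S. count_list (l u) v)"

definition threshold_closed :: "('v \<Rightarrow> 'v list) \<Rightarrow> 'v set \<Rightarrow> nat \<Rightarrow> 'v set \<Rightarrow> 'v set \<Rightarrow> bool" where
  "threshold_closed l V T X S \<longleftrightarrow> X \<subseteq> S \<and> S \<subseteq> V \<and> (\<forall>v\<in>V. T \<le> deg l S v \<longrightarrow> v \<in> S)"

definition least_threshold_closed ::
    "('v \<Rightarrow> 'v list) \<Rightarrow> 'v set \<Rightarrow> nat \<Rightarrow> 'v set \<Rightarrow> 'v set \<Rightarrow> bool" where
  "least_threshold_closed l V T X S \<longleftrightarrow>
     threshold_closed l V T X S \<and> (\<forall>S'. threshold_closed l V T X S' \<longrightarrow> S \<subseteq> S')"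

text \<open>The worklist invariant: \<open>xs\<close> lists the nodes enqueued so far, processed or
  not, and \<open>d v\<close> is the number of edges out of \<open>v\<close> scanned so far. The
  bound by \<open>deg\<close> says that only edges into enqueued nodes were counted; the last
  conjunct carries minimality along.\<close>

definition propagated ::
    "('v \<Rightarrow> 'v list) \<Rightarrow> 'v set \<Rightarrow> nat \<Rightarrow> 'v set \<Rightarrow> ('v \<Rightarrow> nat) \<Rightarrow> 'v list \<Rightarrow> bool" where
  "propagated l V T X d xs \<longleftrightarrow>
     distinct xs \<and> set xs \<subseteq> V \<and> (\<forall>v\<in>V. v \<in> set xs \<longleftrightarrow> v \<in> X \<or> T \<le> d v) \<and>
     (\<forall>v. d v \<le> deg l (set xs) v) \<and> (\<forall>S. threshold_closed l V T X S \<longrightarrow> set xs \<subseteq> S)"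

lemma deg_mono: "finite S' \<Longrightarrow> S \<subseteq> S' \<Longrightarrow> deg l S v \<le> deg l S' v"
  unfolding deg_def by (rule sum_mono2) auto

lemma deg_insert: "finite S \<Longrightarrow> u \<notin> S \<Longrightarrow> deg l (insert u S) v = count_list (l u) v + deg l S v"
  unfolding deg_def by simp

lemma propagated_init:
  assumes "distinct xs" "set xs = X" "X \<subseteq> V" "0 < T"
  shows "propagated l V T X (\<lambda>_. 0) xs"
  using assms unfolding propagated_def threshold_closed_def by auto

text \<open>A node that is not a seed is enqueued when its count crosses \<open>T\<close>. This
  happens only once, so \<open>xs\<close> stays distinct. At that moment at least \<open>T\<close>
  of its edges lead into \<open>set xs\<close>, hence into every closed set, which forces the node
  into each of them.\<close>

lemma propagated_step:
  assumes fin: "finite V" and p: "propagated l V T X d xs" and s: "s \<in> V"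
    and lt: "d s < deg l (set xs) s"
  shows "propagated l V T X (d(s := Suc (d s)))
    (if s \<notin> X \<and> d s < T \<and> T \<le> Suc (d s) then xs @ [s] else xs)"
proof (cases "s \<notin> X \<and> d s < T \<and> T \<le> Suc (d s)")
  case True
  have *: "s \<in> S" if S: "threshold_closed l V T X S" for S
  proof -
    have "set xs \<subseteq> S" "S \<subseteq> V" using p S unfolding propagated_def threshold_closed_def by auto
    then have "deg l (set xs) s \<le> deg l S s" using fin by (intro deg_mono) (auto dest: finite_subset)
    then have "T \<le> deg l S s" using lt True by linarith
    then show ?thesis using S s unfolding threshold_closed_def by blast
  qed
  have mono: "deg l (set xs) v \<le> deg l (insert s (set xs)) v" for v
    by (rule deg_mono) auto
  have nin: "s \<notin> set xs" using p s True unfolding propagated_def by auto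
  have "\<forall>v. (d(s := Suc (d s))) v \<le> deg l (set (xs @ [s])) v"
  proof
    fix v
    show "(d(s := Suc (d s))) v \<le> deg l (set (xs @ [s])) v"
      using mono[of v] lt p unfolding propagated_def by (auto intro: order_trans)
  qed
  moreover have "\<forall>v\<in>V. v \<in> set (xs @ [s]) \<longleftrightarrow> v \<in> X \<or> T \<le> (d(s := Suc (d s))) v"
    using p True unfolding propagated_def by auto
  ultimately show ?thesis
    using True p nin s * unfolding propagated_def by (simp add: True)
next
  case False
  then show ?thesis using p lt s unfolding propagated_def by (auto simp: not_le Suc_le_eq)
qed

text \<open>Once every edge into \<open>set xs\<close> has been counted, the test
  \<open>T \<le> d v\<close> is the closure condition itself.\<close>

lemma propagated_finish:
  assumes "propagated l V T X d xs" "X \<subseteq> V" "\<And>v. d v = deg l (set xs) v"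
  shows "least_threshold_closed l V T X (set xs)"
  using assms unfolding propagated_def least_threshold_closed_def threshold_closed_def by auto

text \<open>
  A linked list starting at address \<open>x\<close>; a cell holds an entry and the address of the next cell,
  and address \<open>0\<close> is the end of the list.
\<close>

fun chain :: "nat \<Rightarrow> nat \<Rightarrow> (nat \<Rightarrow> nat) \<Rightarrow> nat \<Rightarrow> nat list \<Rightarrow> bool" where
  "chain lo hi m x [] \<longleftrightarrow> x = 0"
| "chain lo hi m x (s # ss) \<longleftrightarrow>
     0 < x \<and> lo \<le> x \<and> x + 1 < hi \<and> m x = s \<and> chain lo hi m (m (x + 1)) ss"

text \<open>The bounds confine all cells of a list to one region, so writes to heads, counters,
  queue or fresh cells leave it intact.\<close>

lemma chain_cong:
  "chain lo hi m x ss \<Longrightarrow> (\<And>y. lo \<le> y \<Longrightarrow> y < hi \<Longrightarrow> m' y = m y) \<Longrightarrow> hi \<le> hi' \<Longrightarrow>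
    chain lo hi' m' x ss"
  by (induction ss arbitrary: x) auto

section \<open>The closure program\<close>

abbreviation (input) rZero :: nat where "rZero \<equiv> 2"
abbreviation (input) rOne :: nat where "rOne \<equiv> 3"
abbreviation (input) rBase :: nat where "rBase \<equiv> 9"
abbreviation (input) rNodes :: nat where "rNodes \<equiv> 10"
abbreviation (input) rFree :: nat where "rFree \<equiv> 11"
abbreviation (input) rThr :: nat where "rThr \<equiv> 27"
abbreviation (input) rV :: nat where "rV \<equiv> 28"
abbreviation (input) rEnd :: nat where "rEnd \<equiv> 29"
abbreviation (input) rTail :: nat where "rTail \<equiv> 30"
abbreviation (input) rHead :: nat where "rHead \<equiv> 31"
abbreviation (input) rPtr :: nat where "rPtr \<equiv> 32"
abbreviation (input) rX :: nat where "rX \<equiv> 33"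
abbreviation (input) rY :: nat where "rY \<equiv> 34"

text \<open>The counter holds the number of edges still missing and stays at 0 once it gets there.
  Hence 0 marks the enqueued nodes, and the first test prevents a second enqueueing.\<close>

definition scan_edge :: com where
  "scan_edge = block
    [Load rV rPtr, Add rX rV rNodes, Load rY rX,
     IfLess rZero rY
       (block [Sub rY rY rOne, Store rX rY,
         IfLess rZero rY Skip (block [Store rTail rV, Add rTail rTail rOne])])
       Skip,
     Add rPtr rPtr rOne, Load rPtr rPtr]"

definition scan_edges :: com where
  "scan_edges = WhileLess rZero rPtr scan_edge"

definition init_node :: com where
  "init_node = block
    [Add rX rV rNodes, Load rY rX,
     IfLess rZero rY
       (block [Store rX rZero, Store rTail rV, Add rTail rTail rOne])
       (Store rX rThr),
     Add rV rV rOne]"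

definition init_queue :: com where
  "init_queue = block
    [Add rV rBase rZero, Add rEnd rBase rNodes, Add rTail rFree rZero,
     WhileLess rV rEnd init_node]"

definition process_node :: com where
  "process_node = block
    [Load rPtr rHead, Add rHead rHead rOne, Load rPtr rPtr, scan_edges]"

text \<open>
  The nodes are the addresses \<open>B, \<dots>, B + N - 1\<close>. The word at \<open>v\<close> points to the list of predecessors of \<open>v\<close>, the
  word at \<open>v + N\<close> is a counter. On entry the nodes with a nonzero counter form the seed set; on exit the
  nodes with counter \<open>0\<close> form the least set that contains the seeds and every node with at least \<open>r\<^sub>T\<close> edges
  into the set, \<open>r\<^sub>T\<close> being the threshold. Thus the complement of the output of one run is the seed set of
  the next.
\<close>

definition closure :: com where
  "closure = block
    [init_queue, Add rHead rFree rZero,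
     WhileLess rHead rTail process_node]"

section \<open>Verification of the closure program\<close>

definition same_regs :: "(nat \<Rightarrow> nat) \<Rightarrow> (nat \<Rightarrow> nat) \<Rightarrow> bool" where
  "same_regs r r' \<longleftrightarrow> (\<forall>x. x \<notin> {rV, rEnd, rTail, rHead, rPtr, rX, rY} \<longrightarrow> r' x = r x)"

text \<open>\<open>r0\<close> and \<open>m0\<close> are the registers and memory on entry. The list
  cells lie between \<open>H\<close> and \<open>F\<close>, and the queue starts at \<open>F\<close>;
  as no node is enqueued twice, it fits into \<open>N\<close> words, whence
  \<open>F + N \<le> W\<close>. The threshold is positive because a node enters the queue only as a
  seed or when one of its edges is scanned.\<close>

locale graph_memory =
  fixes W B N H F T :: nat and l :: "nat \<Rightarrow> nat list" and r0 m0 :: "nat \<Rightarrow> nat"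
  assumes regs: "r0 rZero = 0" "r0 rOne = 1" "r0 rBase = B" "r0 rNodes = N" "r0 rFree = F" "r0 rThr = T"
    and layout: "H = B + 2 * N" "H \<le> F" "F + N \<le> W"
    and thr: "0 < T"
    and chains: "\<And>v. v \<in> {B..<B + N} \<Longrightarrow> chain H F m0 (m0 v) (l v)"
    and targets: "\<And>v. v \<in> {B..<B + N} \<Longrightarrow> set (l v) \<subseteq> {B..<B + N}"
begin

abbreviation V where "V \<equiv> {B..<B + N}"

definition X where "X = {v \<in> V. 0 < m0 (v + N)}"

definition frame :: "(nat \<Rightarrow> nat) \<Rightarrow> (nat \<Rightarrow> nat) \<Rightarrow> nat list \<Rightarrow> bool" where
  "frame r m xs \<longleftrightarrow> same_regs r0 r \<and> r rTail = F + length xs \<and> length xs \<le> N \<and>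
     (\<forall>j<length xs. m (F + j) = xs ! j) \<and> (\<forall>x<F. x \<notin> {B + N..<B + 2 * N} \<longrightarrow> m x = m0 x)"

lemma init_queue_spec:
  "wp W init_queue (\<lambda>r m u'. \<exists>xs. frame r m xs \<and> distinct xs \<and> set xs = X \<and>
     (\<forall>v\<in>V. m (v + N) = (if v \<in> X then 0 else T)) \<and> u' \<le> u + 5 + 10 * N) r0 m0 u"
proof -
  \<comment> \<open>Each node costs 10 units: 9 for the longer branch of \<open>init_node\<close>
    and one for the loop test. The 5 in the claim are three assignments, the failing test and the
    closing \<open>Skip\<close>.\<close>
  define J where "J i r m u' \<longleftrightarrow> (\<exists>xs. frame r m xs \<and> distinct xs \<and> length xs \<le> i \<and> i \<le> N \<and>
     set xs = {v \<in> X. v < B + i} \<and> r rV = B + i \<and> r rEnd = B + N \<and>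
     (\<forall>v\<in>V. m (v + N) = (if v < B + i then if v \<in> X then 0 else T else m0 (v + N))) \<and>
     u' \<le> u + 3 + 10 * i)" for i r m u'
  have step: "wp W init_node (J (Suc i)) r m (u' + 1)" if i: "i < N" and J: "J i r m u'" for i r m u'
  proof -
    obtain xs where xs: "frame r m xs" "distinct xs" "length xs \<le> i"
      "set xs = {v \<in> X. v < B + i}" "r rV = B + i" "r rEnd = B + N"
      "\<And>v. v\<in>V \<Longrightarrow> m (v + N) = (if v < B + i then if v \<in> X then 0 else T else m0 (v + N))"
      "u' \<le> u + 3 + 10 * i" using J unfolding J_def by blast
    have rr: "r rZero = 0" "r rOne = 1" "r rNodes = N" "r rThr = T" "r rTail = F + length xs"
      using xs(1) regs unfolding frame_def same_regs_def by auto
    have mi: "m (B + i + N) = m0 (B + i + N)" using xs(7)[of "B + i"] i by simp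
    have XB: "B + i \<in> X \<longleftrightarrow> 0 < m0 (B + i + N)" unfolding X_def using i by auto
    have bounds: "B + i + N \<le> W" "F + length xs + 1 \<le> W" "B + i + 1 \<le> W"
      using i xs(3) layout by auto
    show ?thesis
    proof (cases "0 < m0 (B + i + N)")
      case True
      have "J (Suc i) r' m' u''" if "frame r' m' (xs @ [B + i])" "r' rV = B + Suc i" "r' rEnd = B + N"
        "u'' \<le> u' + 10" "m' = m(B + i + N := 0, F + length xs := B + i)" for r' m' u''
        unfolding J_def
        by (rule exI[of _ "xs @ [B + i]"])
           (use that xs i True XB layout in \<open>auto simp: less_Suc_eq\<close>)
      then show ?thesis
        using True bounds xs(1,3,5,6) layout i
        by (simp add: init_node_def wp_simps rr mi) (auto simp: frame_def same_regs_def nth_append less_Suc_eq)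
    next
      case False
      have "J (Suc i) r' m' u''" if "frame r' m' xs" "r' rV = B + Suc i" "r' rEnd = B + N"
        "u'' \<le> u' + 10" "m' = m(B + i + N := T)" for r' m' u''
        unfolding J_def
        by (rule exI[of _ xs])
           (use that xs i False XB layout in \<open>auto simp: less_Suc_eq\<close>)
      then show ?thesis
        using False bounds xs(1,3,5,6) layout i
        by (simp add: init_node_def wp_simps rr mi) (auto simp: frame_def same_regs_def)
    qed
  qed
  have loop: "wp W (WhileLess rV rEnd init_node) Q r m u'"
    if "J 0 r m u'" "\<And>r m u'. J N r m u' \<Longrightarrow> Q r m (u' + 1)" for Q r m u'
    by (rule wp_for[where J = J and a = B and n = N])
       (use that step in \<open>auto simp: J_def\<close>)
  have init: "J 0 (r0(rV := B, rEnd := B + N, rTail := F)) m0 u'" if "u' \<le> u + 3" for u'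
    using regs that unfolding J_def frame_def same_regs_def X_def by (intro exI[of _ "[]"]) auto
  have exit: "\<exists>xs. frame r m xs \<and> distinct xs \<and> set xs = X \<and>
     (\<forall>v\<in>V. m (v + N) = (if v \<in> X then 0 else T)) \<and> u' + 2 \<le> u + 5 + 10 * N"
    if "J N r m u'" for r m u'
    using that unfolding J_def X_def by (elim exE) (rule exI, auto)
  show ?thesis
    using layout unfolding init_queue_def
    by (simp add: wp_simps regs split del: if_split)
       (rule loop, rule init, simp, drule exit, simp add: wp_simps split del: if_split)
qed


text \<open>\<open>d\<close> is a ghost variable. It may grow beyond \<open>T\<close> while the
  counter stays at 0, which the truncated subtraction expresses.\<close>

definition state :: "(nat \<Rightarrow> nat) \<Rightarrow> nat list \<Rightarrow> (nat \<Rightarrow> nat) \<Rightarrow> (nat \<Rightarrow> nat) \<Rightarrow> bool" where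
  "state d xs r m \<longleftrightarrow> frame r m xs \<and> propagated l V T X d xs \<and>
     (\<forall>v\<in>V. m (v + N) = (if v \<in> X then 0 else T - d v))"

lemma length_le_nodes: "propagated l V T X d xs \<Longrightarrow> length xs \<le> N"
  unfolding propagated_def by (metis card_atLeastLessThan card_mono diff_add_inverse distinct_card
      finite_atLeastLessThan)

lemma scan_edge_spec:
  assumes st: "state d xs r m" and ch: "chain H F m0 (r rPtr) (s # ys)" and s: "s \<in> V"
    and lt: "d s < deg l (set xs) s"
  shows "wp W scan_edge (\<lambda>r' m' u'. \<exists>zs. state (d(s := Suc (d s))) (xs @ zs) r' m' \<and>
     chain H F m0 (r' rPtr) ys \<and> r' rHead = r rHead \<and> u' \<le> u + 14) r m u"
proof -
  let ?P = "r rPtr"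
  let ?d = "d(s := Suc (d s))"
  have fr: "frame r m xs" and pr: "propagated l V T X d xs"
    and cnt: "\<And>v. v \<in> V \<Longrightarrow> m (v + N) = (if v \<in> X then 0 else T - d v)"
    using st unfolding state_def by auto
  have rr: "r rZero = 0" "r rOne = 1" "r rNodes = N" "r rTail = F + length xs"
    using fr regs unfolding frame_def same_regs_def by auto
  have low: "\<And>x. x < F \<Longrightarrow> x \<notin> {B + N..<B + 2 * N} \<Longrightarrow> m x = m0 x"
    using fr unfolding frame_def by auto
  have P: "H \<le> ?P" "?P + 1 < F" and mP: "m ?P = s" and chys: "chain H F m0 (m0 (?P + 1)) ys"
    using ch low[of ?P] layout by auto
  have ms: "m (s + N) = (if s \<in> X then 0 else T - d s)" using cnt s by blast
  \<comment> \<open>The writes hit a counter, which lies below \<open>H\<close>, or the queue, which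
    starts at \<open>F\<close>; so the pointer to the next cell is still the one in
    \<open>m0\<close>.\<close>
  have next_cell: "m (Suc ?P) = m0 (Suc ?P)" "Suc ?P \<noteq> s + N" "Suc ?P \<noteq> F + length xs"
    using P layout s low[of "Suc ?P"] by auto
  have bounds: "s + N \<le> W" "Suc ?P \<le> W" using s P layout by auto
  have pr': "propagated l V T X ?d
    (if s \<notin> X \<and> d s < T \<and> T \<le> Suc (d s) then xs @ [s] else xs)"
    by (rule propagated_step[OF _ pr s lt]) simp
  \<comment> \<open>The three paths through the program: the counter drops from 1 to 0, drops but
    stays positive, or is 0 already. The first is the longest, with 14 units.\<close>
  consider (new) "s \<notin> X" "T = Suc (d s)" | (more) "s \<notin> X" "Suc (d s) < T" | (old) "s \<in> X \<or> T \<le> d s"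
    by linarith
  then show ?thesis
  proof cases
    case new
    then have pr2: "propagated l V T X ?d (xs @ [s])" using pr' by simp
    have len: "Suc (length xs) \<le> N" using length_le_nodes[OF pr2] by simp
    have fin: "\<exists>zs. state ?d (xs @ zs) r' m' \<and> chain H F m0 (r' rPtr) ys \<and> r' rHead = r rHead \<and> u' \<le> u + 14"
      if "same_regs r r'" "r' rTail = Suc (F + length xs)" "m' = m(s + N := 0, F + length xs := s)"
        "r' rPtr = m0 (Suc ?P)" "r' rHead = r rHead" "u' \<le> u + 14"
      for r' m' u'
    proof (rule exI[of _ "[s]"], intro conjI)
      have "frame r' m' (xs @ [s])"
        using fr that(1,2,3) len s layout
        by (auto simp: frame_def same_regs_def nth_append less_Suc_eq)
      moreover have "m' (v + N) = (if v \<in> X then 0 else T - ?d v)" if "v \<in> V" for v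
        using that cnt[OF that] \<open>m' = _\<close> new layout by auto
      ultimately show "state ?d (xs @ [s]) r' m'"
        using pr2 unfolding state_def by blast
    qed (use that chys in auto)
    \<comment> \<open>The symbolic execution is done for an arbitrary \<open>Q\<close>, which keeps
      the existential postcondition away from the simplifier. The same device recurs below.\<close>
    have "wp W scan_edge Q r m u"
      if "\<And>r' m' u'. same_regs r r' \<Longrightarrow> r' rTail = Suc (F + length xs) \<Longrightarrow>
        m' = m(s + N := 0, F + length xs := s) \<Longrightarrow> r' rPtr = m0 (Suc ?P) \<Longrightarrow>
        r' rHead = r rHead \<Longrightarrow> u' \<le> u + 14 \<Longrightarrow> Q r' m' u'" for Q
      using bounds len layout(3)
      by (simp add: scan_edge_def wp_simps rr mP ms next_cell new)
         (rule that, simp_all add: same_regs_def)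
    then show ?thesis by this (rule fin)
  next
    case more
    then have pr2: "propagated l V T X ?d xs" using pr' by simp
    have fin: "\<exists>zs. state ?d (xs @ zs) r' m' \<and> chain H F m0 (r' rPtr) ys \<and> r' rHead = r rHead \<and> u' \<le> u + 14"
      if "same_regs r r'" "r' rTail = F + length xs" "m' = m(s + N := T - Suc (d s))"
        "r' rPtr = m0 (Suc ?P)" "r' rHead = r rHead" "u' \<le> u + 14"
      for r' m' u'
    proof (rule exI[of _ "[]"], intro conjI)
      have "frame r' m' xs"
        using fr that(1,2,3) s layout by (auto simp: frame_def same_regs_def)
      moreover have "m' (v + N) = (if v \<in> X then 0 else T - ?d v)" if "v \<in> V" for v
        using that cnt[OF that] \<open>m' = _\<close> more layout by auto
      ultimately show "state ?d (xs @ []) r' m'"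
        using pr2 unfolding state_def by simp
    qed (use that chys in auto)
    have "wp W scan_edge Q r m u"
      if "\<And>r' m' u'. same_regs r r' \<Longrightarrow> r' rTail = F + length xs \<Longrightarrow>
        m' = m(s + N := T - Suc (d s)) \<Longrightarrow> r' rPtr = m0 (Suc ?P) \<Longrightarrow>
        r' rHead = r rHead \<Longrightarrow> u' \<le> u + 14 \<Longrightarrow> Q r' m' u'" for Q
      using bounds more
      by (simp add: scan_edge_def wp_simps rr mP ms next_cell)
         (rule that, simp_all add: same_regs_def rr)
    then show ?thesis by this (rule fin)
  next
    case old
    then have pr2: "propagated l V T X ?d xs" using pr' by (auto split: if_splits)
    have fin: "\<exists>zs. state ?d (xs @ zs) r' m' \<and> chain H F m0 (r' rPtr) ys \<and> r' rHead = r rHead \<and> u' \<le> u + 14"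
      if "same_regs r r'" "r' rTail = F + length xs" "m' = m"
        "r' rPtr = m0 (Suc ?P)" "r' rHead = r rHead" "u' \<le> u + 14"
      for r' m' u'
    proof (rule exI[of _ "[]"], intro conjI)
      have "frame r' m' xs"
        using fr that(1,2,3) s layout by (auto simp: frame_def same_regs_def)
      moreover have "m' (v + N) = (if v \<in> X then 0 else T - ?d v)" if "v \<in> V" for v
        using that cnt[OF that] \<open>m' = _\<close> old layout by auto
      ultimately show "state ?d (xs @ []) r' m'"
        using pr2 unfolding state_def by simp
    qed (use that chys in auto)
    have "m (s + N) = 0" using ms old by auto
    then have "wp W scan_edge Q r m u"
      if "\<And>r' m' u'. same_regs r r' \<Longrightarrow> r' rTail = F + length xs \<Longrightarrow>
        m' = m \<Longrightarrow> r' rPtr = m0 (Suc ?P) \<Longrightarrow>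
        r' rHead = r rHead \<Longrightarrow> u' \<le> u + 14 \<Longrightarrow> Q r' m' u'" for Q
      using bounds
      by (simp add: scan_edge_def wp_simps rr mP next_cell)
         (rule that, simp_all add: same_regs_def rr)
    then show ?thesis by this (rule fin)
  qed
qed

text \<open>The last hypothesis supplies \<open>d s < deg l (set xs) s\<close> at every single edge:
  counted and pending edges together never exceed the edges into enqueued nodes. It survives growth
  of the queue, since \<open>deg\<close> is monotone in the set.\<close>

lemma scan_edges_spec:
  assumes "state d xs r m" "chain H F m0 (r rPtr) ys" "set ys \<subseteq> V"
    and "\<And>v. d v + count_list ys v \<le> deg l (set xs) v"
  shows "wp W scan_edges (\<lambda>r' m' u'. \<exists>zs. state (\<lambda>v. d v + count_list ys v) (xs @ zs) r' m' \<and>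
     r' rHead = r rHead \<and> u' \<le> u + 1 + 15 * length ys) r m u"
  using assms
proof (induction ys arbitrary: d xs r m u)
  case Nil
  then have "r rPtr = 0" "r rZero = 0"
    using regs unfolding state_def frame_def same_regs_def by auto
  then show ?case
    unfolding scan_edges_def using Nil by (intro wp_While_False) (auto intro: exI[of _ "[]"])
next
  case (Cons s ys)
  have "r rZero = 0" using Cons.prems(1) regs unfolding state_def frame_def same_regs_def by auto
  then have pos: "r rZero < r rPtr" using Cons.prems(2) by simp
  have s: "s \<in> V" "d s < deg l (set xs) s" using Cons.prems(3) Cons.prems(4)[of s] by auto
  show ?case
    unfolding scan_edges_def
  proof (rule wp_While_True, rule pos, rule wp_conseq[OF scan_edge_spec[OF Cons.prems(1,2) s]],
      fold scan_edges_def, elim exE conjE)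
    fix r' m' u' zs
    let ?d = "d(s := Suc (d s))"
    assume *: "state ?d (xs @ zs) r' m'" "chain H F m0 (r' rPtr) ys" "r' rHead = r rHead" "u' \<le> u + 1 + 14"
    have eq: "?d v + count_list ys v = d v + count_list (s # ys) v" for v by simp
    have "deg l (set xs) v \<le> deg l (set (xs @ zs)) v" for v by (rule deg_mono) auto
    then have "?d v + count_list ys v \<le> deg l (set (xs @ zs)) v" for v
      using Cons.prems(4)[of v] unfolding eq by (meson order_trans)
    then have "wp W scan_edges (\<lambda>r'' m'' u''. \<exists>zs'. state (\<lambda>v. ?d v + count_list ys v) ((xs @ zs) @ zs') r'' m'' \<and>
       r'' rHead = r' rHead \<and> u'' \<le> u' + 1 + 15 * length ys) r' m' u'"
      using Cons.prems(3) by (intro Cons.IH *) auto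
    then show "wp W scan_edges (\<lambda>r' m' u'. \<exists>zs. state (\<lambda>v. d v + count_list (s # ys) v) (xs @ zs) r' m' \<and>
       r' rHead = r rHead \<and> u' \<le> u + 1 + 15 * length (s # ys)) r' m' u'"
      unfolding eq
    proof (rule wp_conseq, elim exE conjE)
      fix r'' m'' u'' zs'
      assume "state (\<lambda>v. d v + count_list (s # ys) v) ((xs @ zs) @ zs') r'' m''"
        "r'' rHead = r' rHead" "u'' \<le> u' + 1 + 15 * length ys"
      then show "\<exists>zs. state (\<lambda>v. d v + count_list (s # ys) v) (xs @ zs) r'' m'' \<and>
          r'' rHead = r rHead \<and> u'' \<le> u + 1 + 15 * length (s # ys)"
        using * by (intro exI[of _ "zs @ zs'"]) (auto simp del: count_list.simps)
    qed
  qed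
qed

lemma closure_spec:
  "wp W closure (\<lambda>r m u'. same_regs r0 r \<and> (\<forall>x<F. x \<notin> {B + N..<B + 2 * N} \<longrightarrow> m x = m0 x) \<and>
     (\<exists>S. least_threshold_closed l V T X S \<and> (\<forall>v\<in>V. m (v + N) = 0 \<longleftrightarrow> v \<in> S)) \<and>
     u' \<le> u + 8 + 16 * N + 15 * (\<Sum>v\<in>V. length (l v))) r0 m0 u"
proof -
  \<comment> \<open>Amortisation: the elapsed time plus the cost of all unprocessed nodes stays
    below a fixed bound. The 6 units per node are the outer loop test, three instructions, the
    failing test of \<open>scan_edges\<close> and a \<open>Skip\<close>; each edge takes 14 units
    and a test.\<close>
  define cost where "cost S = (\<Sum>v\<in>S. 6 + 15 * length (l v))" for S
  \<comment> \<open>The ghost count is that of the edges into the processed prefix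
    \<open>take i xs\<close>. When the queue is exhausted, the prefix is all of \<open>xs\<close>
    and \<open>propagated_finish\<close> applies.\<close>
  define I where "I j r m u' \<longleftrightarrow> (\<exists>xs i. i \<le> length xs \<and> j = N - i \<and> r rHead = F + i \<and>
     state (deg l (set (take i xs))) xs r m \<and> u' + cost (V - set (take i xs)) \<le> u + 6 + 10 * N + cost V)"
    for j r m u'
  have step: "wp W process_node (\<lambda>r m u. \<exists>j'<j. I j' r m u) r m (u' + 1)"
    if I: "I j r m u'" and less: "r rHead < r rTail" for j r m u'
  proof -
    obtain xs i where i: "i \<le> length xs" "j = N - i" "r rHead = F + i"
      and st: "state (deg l (set (take i xs))) xs r m"
      and time: "u' + cost (V - set (take i xs)) \<le> u + 6 + 10 * N + cost V"
      using I unfolding I_def by blast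
    have fr: "frame r m xs" and pr: "propagated l V T X (deg l (set (take i xs))) xs"
      using st unfolding state_def by auto
    have rr: "r rOne = 1" "r rTail = F + length xs"
      using fr regs unfolding frame_def same_regs_def by auto
    have il: "i < length xs" using less i rr by simp
    have iN: "i < N" using il length_le_nodes[OF pr] by simp
    define v where "v = xs ! i"
    have mv: "m (F + i) = v" using fr il unfolding frame_def v_def by auto
    have v: "v \<in> V" using pr il unfolding propagated_def v_def using nth_mem by blast
    have hv: "m v = m0 v" using fr v layout unfolding frame_def by auto
    have tk: "take (Suc i) xs = take i xs @ [v]" using il unfolding v_def by (rule take_Suc_conv_app_nth)
    have dist: "distinct xs" using pr unfolding propagated_def by blast
    then have nin: "v \<notin> set (take i xs)" using tk by (metis distinct_take not_distinct_conv_prefix)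
    have d_eq: "deg l (set (take i xs)) w + count_list (l v) w = deg l (set (take (Suc i) xs)) w" for w
      using deg_insert[of "set (take i xs)" v l w] nin tk by simp
    let ?u = "Suc (Suc (Suc (Suc u')))"
    let ?r = "r(rHead := Suc (F + i), rPtr := m0 v)"
    have st': "state (deg l (set (take i xs))) xs ?r m"
      using st unfolding state_def frame_def same_regs_def by auto
    have "wp W scan_edges (\<lambda>r' m' u''. \<exists>zs. state (\<lambda>w. deg l (set (take i xs)) w + count_list (l v) w) (xs @ zs) r' m' \<and>
       r' rHead = ?r rHead \<and> u'' \<le> ?u + 1 + 15 * length (l v)) ?r m ?u"
    proof (rule scan_edges_spec[OF st'])
      show "chain H F m0 (?r rPtr) (l v)" using chains[OF v] by simp
      show "set (l v) \<subseteq> V" using targets[OF v] .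
      show "deg l (set (take i xs)) w + count_list (l v) w \<le> deg l (set xs) w" for w
        unfolding d_eq by (rule deg_mono) (auto dest: in_set_takeD)
    qed
    then have "wp W scan_edges (\<lambda>r' m' u''. \<exists>j'<j. I j' r' m' (u'' + 1)) ?r m ?u"
    proof (rule wp_conseq, elim exE conjE)
      fix r' m' u'' zs
      assume *: "state (\<lambda>w. deg l (set (take i xs)) w + count_list (l v) w) (xs @ zs) r' m'"
        "r' rHead = ?r rHead" "u'' \<le> ?u + 1 + 15 * length (l v)"
      have "cost (V - set (take i xs)) = (6 + 15 * length (l v)) + cost (V - set (take i xs) - {v})"
        unfolding cost_def by (rule sum.remove) (use v nin in auto)
      also have "V - set (take i xs) - {v} = V - set (take (Suc i) xs)" unfolding tk by auto
      finally have "I (N - Suc i) r' m' (u'' + 1)"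
        unfolding I_def using * time il d_eq
        by (intro exI[of _ "xs @ zs"] exI[of _ "Suc i"]) auto
      then show "\<exists>j'<j. I j' r' m' (u'' + 1)" using iN i by (intro exI[of _ "N - Suc i"]) auto
    qed
    then have "wp W scan_edges (wp W (block []) (\<lambda>r' m' u''. \<exists>j'<j. I j' r' m' u'')) ?r m ?u"
      by (rule wp_conseq) (simp add: wp_block_Nil)
    then show ?thesis
      using iN layout
      by (simp add: process_node_def wp_block_Cons) (simp add: wp_simps rr i mv hv)
  qed
  have exit: "same_regs r0 r \<and> (\<forall>x<F. x \<notin> {B + N..<B + 2 * N} \<longrightarrow> m x = m0 x) \<and>
     (\<exists>S. least_threshold_closed l V T X S \<and> (\<forall>v\<in>V. m (v + N) = 0 \<longleftrightarrow> v \<in> S)) \<and>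
     u' + 2 \<le> u + 8 + 16 * N + 15 * (\<Sum>v\<in>V. length (l v))"
    if I: "I j r m u'" and nl: "\<not> r rHead < r rTail" for j r m u'
  proof -
    obtain xs i where i: "i \<le> length xs" "r rHead = F + i"
      and st: "state (deg l (set (take i xs))) xs r m"
      and time: "u' \<le> u + 6 + 10 * N + cost V"
      using I unfolding I_def by auto
    have fr: "frame r m xs" and pr: "propagated l V T X (deg l (set (take i xs))) xs"
      and cnt: "\<And>v. v \<in> V \<Longrightarrow> m (v + N) = (if v \<in> X then 0 else T - deg l (set (take i xs)) v)"
      using st unfolding state_def by auto
    have "r rTail = F + length xs" using fr unfolding frame_def by blast
    then have "take i xs = xs" using nl i by simp
    then have "least_threshold_closed l V T X (set xs)"
      by (intro propagated_finish[OF pr]) (auto simp: X_def)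
    moreover have "m (v + N) = 0 \<longleftrightarrow> v \<in> set xs" if "v \<in> V" for v
      using cnt[OF that] pr that unfolding propagated_def by auto
    moreover have "cost V = 6 * N + 15 * (\<Sum>v\<in>V. length (l v))"
      unfolding cost_def by (simp add: sum.distrib sum_distrib_left)
    ultimately show ?thesis using fr time unfolding frame_def by auto
  qed
  have init: "I N (r(rHead := F)) m (u' + 1)"
    if "frame r m xs" "distinct xs" "set xs = X" "\<forall>v\<in>V. m (v + N) = (if v \<in> X then 0 else T)"
      "u' \<le> u + 5 + 10 * N" for r m u' xs
    unfolding I_def
  proof (rule exI[of _ xs], rule exI[of _ 0], intro conjI)
    have "propagated l V T X (\<lambda>_. 0) xs"
      using that thr by (intro propagated_init) (auto simp: X_def)
    moreover have "deg l {} = (\<lambda>_. 0)" by (simp add: deg_def fun_eq_iff)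
    ultimately show "state (deg l (set (take 0 xs))) xs (r(rHead := F)) m"
      using that unfolding state_def frame_def same_regs_def by auto
  qed (use that in auto)
  show ?thesis
    unfolding closure_def wp_block_Cons
  proof (rule wp_conseq[OF init_queue_spec], elim exE conjE)
    fix r m u' xs
    assume *: "frame r m xs" "distinct xs" "set xs = X" "\<forall>v\<in>V. m (v + N) = (if v \<in> X then 0 else T)"
      "u' \<le> u + 5 + 10 * N"
    have rr: "r rFree = F" "r rZero = 0" using *(1) regs unfolding frame_def same_regs_def by auto
    have "wp W (WhileLess rHead rTail process_node) (wp W (block [])
      (\<lambda>r m u'. same_regs r0 r \<and> (\<forall>x<F. x \<notin> {B + N..<B + 2 * N} \<longrightarrow> m x = m0 x) \<and>
       (\<exists>S. least_threshold_closed l V T X S \<and> (\<forall>v\<in>V. m (v + N) = 0 \<longleftrightarrow> v \<in> S)) \<and>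
       u' \<le> u + 8 + 16 * N + 15 * (\<Sum>v\<in>V. length (l v)))) (r(rHead := F)) m (u' + 1)"
      by (rule wp_while[where I = I, OF init[OF *]])
         (use step exit in \<open>simp_all add: wp_block_Nil\<close>)
    then show "wp W (Add rHead rFree rZero) (wp W (WhileLess rHead rTail process_node) (wp W (block [])
      (\<lambda>r m u'. same_regs r0 r \<and> (\<forall>x<F. x \<notin> {B + N..<B + 2 * N} \<longrightarrow> m x = m0 x) \<and>
       (\<exists>S. least_threshold_closed l V T X S \<and> (\<forall>v\<in>V. m (v + N) = 0 \<longleftrightarrow> v \<in> S)) \<and>
       u' \<le> u + 8 + 16 * N + 15 * (\<Sum>v\<in>V. length (l v))))) r m u'"
      using layout by (simp add: wp_Add rr)
  qed
qed

end

section \<open>Building the reversed alignment automaton in memory\<close>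

abbreviation (input) rN :: nat where "rN \<equiv> 4"
abbreviation (input) rK :: nat where "rK \<equiv> 5"
abbreviation (input) rTab :: nat where "rTab \<equiv> 6"
abbreviation (input) rSq :: nat where "rSq \<equiv> 7"
abbreviation (input) rMul :: nat where "rMul \<equiv> 8"
abbreviation (input) rP :: nat where "rP \<equiv> 12"
abbreviation (input) rQ :: nat where "rQ \<equiv> 13"
abbreviation (input) rA :: nat where "rA \<equiv> 14"
abbreviation (input) rRowP :: nat where "rRowP \<equiv> 15"
abbreviation (input) rRowQ :: nat where "rRowQ \<equiv> 16"
abbreviation (input) rCell :: nat where "rCell \<equiv> 17"
abbreviation (input) rAccP :: nat where "rAccP \<equiv> 18"
abbreviation (input) rFlagP :: nat where "rFlagP \<equiv> 19"
abbreviation (input) rAccQ :: nat where "rAccQ \<equiv> 20"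
abbreviation (input) rFlagQ :: nat where "rFlagQ \<equiv> 21"
abbreviation (input) rLine :: nat where "rLine \<equiv> 22"
abbreviation (input) rBoth :: nat where "rBoth \<equiv> 23"
abbreviation (input) rSkip :: nat where "rSkip \<equiv> 24"
abbreviation (input) rOff :: "nat \<Rightarrow> nat" where "rOff c \<equiv> 40 + c"

definition control_moves :: "(nat \<times> bool) list" where
  "control_moves = List.product [0..<6] [True, False]"

text \<open>The control automaton is compiled into the program: \<open>ctl c b\<close> is evaluated
  when the command is formed, and only the register with its offset occurs. The command prepends a
  cell with the source node to the list of the target.\<close>

definition link :: "(nat \<Rightarrow> bool \<Rightarrow> nat) \<Rightarrow> nat \<times> bool \<Rightarrow> com" where
  "link ctl = (\<lambda>(c, b). block
    [Add rX rCell (rOff c), Store rFree rX, Add rFree rFree rOne,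
     Add rX (if b then rBoth else rSkip) (rOff (ctl c b)), Load rY rX, Store rFree rY,
     Sub rY rFree rOne, Store rX rY, Add rFree rFree rOne])"

definition letter_body :: "(nat \<Rightarrow> bool \<Rightarrow> nat) \<Rightarrow> com" where
  "letter_body ctl = block
    [Add rX rRowP rA, Load rY rX, Add rX rMul rY, Load rBoth rX,
     Add rX rRowQ rA, Load rY rX, Add rBoth rBoth rY, Add rSkip rLine rY,
     block (map (link ctl) control_moves), Add rA rA rOne]"

definition mark :: "nat \<Rightarrow> com" where
  "mark c = block [Add rX rCell (rOff c), Add rX rX rNodes, Store rX rOne]"

definition pair_body :: "(nat \<Rightarrow> bool \<Rightarrow> nat) \<Rightarrow> nat list \<Rightarrow> com" where
  "pair_body ctl accs = block
    [Load rFlagQ rAccQ,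
     IfLess rZero rFlagP (IfLess rZero rFlagQ (block (map mark accs)) Skip) Skip,
     Const rA 0, WhileLess rA rK (letter_body ctl),
     Add rQ rQ rOne, Add rRowQ rRowQ rK, Add rAccQ rAccQ rOne, Add rCell rCell rOne]"

text \<open>The constant 3 is the address of the acceptance vector, which follows the words for
  \<open>n\<close>, \<open>k\<close> and the start state.\<close>

definition row_body :: "(nat \<Rightarrow> bool \<Rightarrow> nat) \<Rightarrow> nat list \<Rightarrow> com" where
  "row_body ctl accs = block
    [Load rFlagP rAccP, Const rQ 0, Add rRowQ rTab rZero, Const rAccQ 3,
     WhileLess rQ rN (pair_body ctl accs),
     Add rP rP rOne, Add rRowP rRowP rK, Add rAccP rAccP rOne, Add rLine rLine rN]"

definition build :: "(nat \<Rightarrow> bool \<Rightarrow> nat) \<Rightarrow> nat list \<Rightarrow> com" where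
  "build ctl accs = block
    [Const rP 0, Add rRowP rTab rZero, Const rAccP 3, Add rLine rBase rZero,
     Add rCell rBase rZero, WhileLess rP rN (row_body ctl accs)]"

section \<open>Verification of the build program\<close>

definition sources :: "(nat \<times> nat) list \<Rightarrow> nat \<Rightarrow> nat list" where
  "sources es v = rev (map fst (filter (\<lambda>e. snd e = v) es))"

text \<open>New cells are put in front of a list; this is why \<open>sources\<close>
  reverses.\<close>

lemma sources_snoc: "sources (es @ [(s, t)]) v = (if v = t then s # sources es v else sources es v)"
  unfolding sources_def by auto

definition keep :: "nat set \<Rightarrow> (nat \<Rightarrow> nat) \<Rightarrow> (nat \<Rightarrow> nat) \<Rightarrow> bool" where
  "keep S r r' \<longleftrightarrow> (\<forall>x. x \<notin> S \<longrightarrow> r' x = r x)"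

text \<open>
  Memory layout: the input below \<open>M\<close>, the table \<open>p \<mapsto> B + p n\<close> from \<open>M\<close> (there is no multiplication
  instruction), list heads of the \<open>N\<close> nodes from \<open>B\<close>, their counters from \<open>B + N\<close>, and the cells of the \<open>E\<close>
  edges from \<open>H\<close>.
\<close>

locale build_memory =
  fixes W n k M B N H E :: nat
    and ctl :: "nat \<Rightarrow> bool \<Rightarrow> nat" and accs :: "nat list"
    and \<delta> :: "nat \<Rightarrow> nat \<Rightarrow> nat" and Acc :: "nat set" and mi :: "nat \<Rightarrow> nat"
  assumes layout: "M = 3 + n + n * k" "B = M + n" "N = 6 * (n * n)" "H = B + 2 * N"
      "E = n * (n * (k * 12))" "H + 2 * E + N \<le> W"
    and ctl: "\<And>c b. c < 6 \<Longrightarrow> ctl c b < 6"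
    and accs: "\<And>c. c \<in> set accs \<Longrightarrow> c < 6" "length accs \<le> 6"
    and \<delta>: "\<And>q a. q < n \<Longrightarrow> a < k \<Longrightarrow> \<delta> q a < n"
    and acc_table: "\<And>q. q < n \<Longrightarrow> mi (3 + q) = (if q \<in> Acc then 1 else 0)"
    and trans_table: "\<And>q a. q < n \<Longrightarrow> a < k \<Longrightarrow> mi (3 + n + q * k + a) = \<delta> q a"
    and mul_table: "\<And>q. q < n \<Longrightarrow> mi (M + q) = B + q * n"
begin

abbreviation V where "V \<equiv> {B..<B + N}"

text \<open>A mixed-radix number with leading digit \<open>c\<close>. From \<open>node 0 p q\<close>
  the six nodes over a pair are reached by adding the constants \<open>c * (n * n)\<close> kept in
  registers, and the next pair by adding 1.\<close>

definition node :: "nat \<Rightarrow> nat \<Rightarrow> nat \<Rightarrow> nat" where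
  "node c p q = B + p * n + q + c * (n * n)"

definition edge :: "nat \<Rightarrow> nat \<Rightarrow> nat \<Rightarrow> nat \<times> bool \<Rightarrow> nat \<times> nat" where
  "edge p q a = (\<lambda>(c, b). (node c p q, node (ctl c b) (if b then \<delta> p a else p) (\<delta> q a)))"

text \<open>The edge lists repeat the nesting of the program loops, so that a loop invariant can
  speak of the part generated by the first \<open>i\<close> iterations.\<close>

definition letter_edges :: "nat \<Rightarrow> nat \<Rightarrow> nat \<Rightarrow> (nat \<times> nat) list" where
  "letter_edges p q a = map (edge p q a) control_moves"

definition pair_edges :: "nat \<Rightarrow> nat \<Rightarrow> (nat \<times> nat) list" where
  "pair_edges p q = concat (map (letter_edges p q) [0..<k])"

definition row_edges :: "nat \<Rightarrow> (nat \<times> nat) list" where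
  "row_edges p = concat (map (pair_edges p) [0..<n])"

definition all_edges :: "(nat \<times> nat) list" where
  "all_edges = concat (map row_edges [0..<n])"

definition marks :: "nat \<Rightarrow> nat \<Rightarrow> nat set" where
  "marks p q = (if p \<in> Acc \<and> q \<in> Acc then (\<lambda>c. node c p q) ` set accs else {})"

lemma length_letter_edges: "length (letter_edges p q a) = 12"
  unfolding letter_edges_def control_moves_def by simp

lemma length_pair_edges: "length (concat (map (letter_edges p q) [0..<i])) = i * 12"
  by (induction i) (simp_all add: length_letter_edges)

lemma length_row_edges: "length (concat (map (pair_edges p) [0..<i])) = i * (k * 12)"
  by (induction i) (simp_all add: pair_edges_def length_pair_edges)

lemma length_edges: "length (concat (map row_edges [0..<i])) = i * (n * (k * 12))"
  by (induction i) (simp_all add: row_edges_def length_row_edges)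

lemma length_all_edges: "length all_edges = E"
  unfolding all_edges_def length_edges using layout(5) by simp

lemma node_in: "c < 6 \<Longrightarrow> p < n \<Longrightarrow> q < n \<Longrightarrow> node c p q \<in> V"
proof -
  assume *: "c < 6" "p < n" "q < n"
  have "p * n + q < Suc p * n" using * by simp
  also have "\<dots> \<le> n * n" using * by (intro mult_le_mono) auto
  finally have "p * n + q + c * (n * n) < Suc c * (n * n)" by simp
  also have "\<dots> \<le> N" unfolding layout using * by (intro mult_le_mono) auto
  finally show ?thesis unfolding node_def by simp
qed

definition fixed_regs :: "(nat \<Rightarrow> nat) \<Rightarrow> bool" where
  "fixed_regs r \<longleftrightarrow> r rZero = 0 \<and> r rOne = 1 \<and> r rN = n \<and> r rK = k \<and> r rTab = 3 + n \<and>
     r rMul = M \<and> r rBase = B \<and> r rNodes = N \<and> (\<forall>c<6. r (rOff c) = c * (n * n))"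

text \<open>\<open>es\<close> and \<open>A\<close> are ghost data: the edges entered and the nodes
  marked as accepting so far. A mark is a nonzero counter, the form in which \<open>closure\<close>
  expects its seeds.\<close>

definition built :: "(nat \<times> nat) list \<Rightarrow> nat set \<Rightarrow> (nat \<Rightarrow> nat) \<Rightarrow> (nat \<Rightarrow> nat) \<Rightarrow> bool" where
  "built es A r m \<longleftrightarrow> fixed_regs r \<and> r rFree = H + 2 * length es \<and> (\<forall>x<B. m x = mi x) \<and>
     (\<forall>v\<in>V. chain H (H + 2 * length es) m (m v) (sources es v)) \<and>
     (\<forall>v\<in>V. m (v + N) = (if v \<in> A then 1 else 0))"

lemma built_regs:
  assumes "built es A r m"
  shows "r rZero = 0" "r rOne = 1" "r rN = n" "r rK = k" "r rTab = 3 + n" "r rMul = M"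
    "r rBase = B" "r rNodes = N" "\<And>c. c < 6 \<Longrightarrow> r (rOff c) = c * (n * n)"
    "r rFree = H + 2 * length es"
  using assms unfolding built_def fixed_regs_def by auto

lemma built_mem: "built es A r m \<Longrightarrow> x < B \<Longrightarrow> m x = mi x"
  unfolding built_def by blast

text \<open>\<open>built\<close> reads only registers below 12 and the offsets from 40 on; registers
  12 to 39 are scratch space.\<close>

lemma built_cong:
  assumes "built es A r m" "keep S r r'" "S \<subseteq> {12..<40}"
  shows "built es A r' m"
proof -
  have "r' x = r x" if "x < 12 \<or> 40 \<le> x" for x
    using that assms(2,3) unfolding keep_def by (metis atLeastLessThan_iff in_mono not_le)
  then show ?thesis using assms(1) unfolding built_def fixed_regs_def by simp
qed

lemma link_spec:
  assumes b: "built es A r m" and len: "length es < E" and c: "c < 6" and pq: "p < n" "q < n" "a < k"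
    and r: "r rCell = node 0 p q" "r rBoth = node 0 (\<delta> p a) (\<delta> q a)" "r rSkip = node 0 p (\<delta> q a)"
  shows "wp W (link ctl (c, x)) (\<lambda>r' m' u'. built (es @ [edge p q a (c, x)]) A r' m' \<and>
     keep {rX, rY, rFree} r r' \<and> u' \<le> u + 10) r m u"
proof -
  note rr = built_regs[OF b]
  define s where "s = node c p q"
  define t where "t = node (ctl c x) (if x then \<delta> p a else p) (\<delta> q a)"
  let ?F = "H + 2 * length es"
  have s: "node 0 p q + c * (n * n) = s" unfolding s_def node_def by simp
  have t: "r (if x then rBoth else rSkip) + ctl c x * (n * n) = t"
    using r unfolding t_def node_def by simp
  have sV: "s \<in> V" and tV: "t \<in> V"
    unfolding s_def t_def using c pq \<delta> ctl by (simp_all add: node_in del: atLeastLessThan_iff)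
  have bounds: "s \<le> W" "t \<le> W" "?F + 2 \<le> W" using sV tV len layout(4,6) by auto
  have tF: "t \<noteq> ?F" "t \<noteq> Suc ?F" "t < H" using tV layout(4) by auto
  have e: "edge p q a (c, x) = (s, t)" unfolding edge_def s_def t_def by simp
  have post: "built (es @ [(s, t)]) A r' m'"
    if k: "keep {rX, rY, rFree} r r'" and f: "r' rFree = ?F + 2"
      and m': "m' = m(?F := s, Suc ?F := m t, t := ?F)" for r' m'
    unfolding built_def
  proof (intro conjI ballI allI impI)
    show "fixed_regs r'" using rr k unfolding fixed_regs_def keep_def by auto
    show "r' rFree = H + 2 * length (es @ [(s, t)])" using f by simp
    show "m' y = mi y" if "y < B" for y
      using that built_mem[OF b] tV layout(4) unfolding m' by auto
    fix v assume v: "v \<in> V"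
    \<comment> \<open>Every old list survives behind its old head: two writes lie at or above its
      upper bound \<open>?F\<close>, the third below \<open>H\<close>. For \<open>v = t\<close> the
      new cell then goes in front of it.\<close>
    have old: "chain H (H + 2 * length (es @ [(s, t)])) m' (m v) (sources es v)"
      by (rule chain_cong[where m = m and hi = ?F])
         (use b v tF in \<open>auto simp: built_def m'\<close>)
    show "chain H (H + 2 * length (es @ [(s, t)])) m' (m' v) (sources (es @ [(s, t)]) v)"
    proof (cases "v = t")
      case True
      then show ?thesis
        using old tF layout by (simp add: sources_snoc m')
    next
      case False
      then have "m' v = m v" using v layout(4) unfolding m' by auto
      then show ?thesis using old False by (simp add: sources_snoc)
    qed
    show "m' (v + N) = (if v \<in> A then 1 else 0)"
    proof -
      have "v + N \<noteq> ?F" "v + N \<noteq> Suc ?F" "v + N \<noteq> t" using v tV layout(4) by auto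
      then show ?thesis using b v unfolding m' built_def by auto
    qed
  qed
  have "wp W (link ctl (c, x)) Q r m u"
    if "\<And>r' m' u'. keep {rX, rY, rFree} r r' \<Longrightarrow> r' rFree = ?F + 2 \<Longrightarrow>
      m' = m(?F := s, Suc ?F := m t, t := ?F) \<Longrightarrow> u' \<le> u + 10 \<Longrightarrow> Q r' m' u'" for Q
  \<comment> \<open>\<open>x\<close> determines which of the registers \<open>rBoth\<close> and
    \<open>rSkip\<close> occurs in the command.\<close>
  proof (cases x)
    case True
    then show ?thesis
      using bounds ctl[OF c, of x] c t
      by (simp add: link_def wp_simps rr r(1) s tF) (rule that, simp_all add: keep_def)
  next
    case False
    then show ?thesis
      using bounds ctl[OF c, of x] c t
      by (simp add: link_def wp_simps rr r(1) s tF) (rule that, simp_all add: keep_def)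
  qed
  then show ?thesis unfolding e by this (use post in auto)
qed


lemma links_spec:
  assumes "built es A r m" "length es + length xs \<le> E" "\<And>c b. (c, b) \<in> set xs \<Longrightarrow> c < 6"
    and pq: "p < n" "q < n" "a < k"
    and "r rCell = node 0 p q" "r rBoth = node 0 (\<delta> p a) (\<delta> q a)" "r rSkip = node 0 p (\<delta> q a)"
  shows "wp W (block (map (link ctl) xs)) (\<lambda>r' m' u'. built (es @ map (edge p q a) xs) A r' m' \<and>
     keep {rX, rY, rFree} r r' \<and> u' \<le> u + 1 + 10 * length xs) r m u"
  using assms
proof (induction xs arbitrary: es r m u)
  case Nil
  then show ?case by (simp add: wp_block_Nil keep_def)
next
  case (Cons cb xs)
  obtain c b where cb: "cb = (c, b)" by force
  have c: "c < 6" "length es < E" using Cons.prems(2,3) cb by auto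
  show ?case
    unfolding list.map wp_block_Cons cb
  proof (rule wp_conseq[OF link_spec[OF Cons.prems(1) c(2,1) pq Cons.prems(7-9)]], elim conjE)
    fix r' m' u'
    assume *: "built (es @ [edge p q a (c, b)]) A r' m'" "keep {rX, rY, rFree} r r'" "u' \<le> u + 10"
    have "wp W (block (map (link ctl) xs)) (\<lambda>r'' m'' u''.
       built ((es @ [edge p q a (c, b)]) @ map (edge p q a) xs) A r'' m'' \<and>
       keep {rX, rY, rFree} r' r'' \<and> u'' \<le> u' + 1 + 10 * length xs) r' m' u'"
      by (rule Cons.IH) (use Cons.prems *(1,2) in \<open>auto simp: keep_def\<close>)
    then show "wp W (block (map (link ctl) xs)) (\<lambda>r' m' u'.
       built (es @ edge p q a (c, b) # map (edge p q a) xs) A r' m' \<and>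
       keep {rX, rY, rFree} r r' \<and> u' \<le> u + 1 + 10 * length ((c, b) # xs)) r' m' u'"
      by (rule wp_conseq) (use * in \<open>auto simp: keep_def\<close>)
  qed
qed

lemma letter_body_spec:
  assumes b: "built es A r m" and len: "length es + 12 \<le> E" and pq: "p < n" "q < n" "a < k"
    and r: "r rCell = node 0 p q" "r rLine = B + p * n" "r rA = a"
      "r rRowP = 3 + n + p * k" "r rRowQ = 3 + n + q * k"
  shows "wp W (letter_body ctl) (\<lambda>r' m' u'. built (es @ letter_edges p q a) A r' m' \<and>
     keep {rX, rY, rFree, rA, rBoth, rSkip} r r' \<and> r' rA = Suc a \<and> u' \<le> u + 131) r m u"
proof -
  note rr = built_regs[OF b]
  have row: "p * k + a < n * k" if "p < n" for p
  proof -
    have "p * k + a < Suc p * k" using pq by simp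
    also have "\<dots> \<le> n * k" using that by (intro mult_le_mono) auto
    finally show ?thesis .
  qed
  have d: "\<delta> p a < n" "\<delta> q a < n" using \<delta> pq by auto
  have mem: "m (3 + n + p * k + a) = \<delta> p a" "m (3 + n + q * k + a) = \<delta> q a"
      "m (M + \<delta> p a) = B + \<delta> p a * n"
    using row[OF pq(1)] row[OF pq(2)] built_mem[OF b] trans_table mul_table pq d layout(1,2) by auto
  have in_V: "node 0 (\<delta> p a) (\<delta> q a) \<in> V" "node 0 p (\<delta> q a) \<in> V"
    using d pq by (auto intro!: node_in simp del: atLeastLessThan_iff)
  have small: "B + N \<le> W" "k \<le> n * k" using layout(4,6) pq by auto
  have bounds: "3 + n + p * k + a \<le> W" "3 + n + q * k + a \<le> W" "M + \<delta> p a \<le> W"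
      "B + \<delta> p a * n + \<delta> q a \<le> W" "B + p * n + \<delta> q a \<le> W" "Suc a \<le> W"
    using row[OF pq(1)] row[OF pq(2)] small in_V layout(1,2) d pq unfolding node_def by auto
  \<comment> \<open>121 = 12 * 10 + 1: ten units for each \<open>link\<close> and one for the
    closing \<open>Skip\<close>. Eight instructions before and two units after give 131.\<close>
  have links: "wp W (block (map (link ctl) control_moves))
      (\<lambda>r' m' u''. built (es @ letter_edges p q a) A r' m' \<and> keep {rX, rY, rFree} r1 r' \<and>
        u'' \<le> u' + 121) r1 m u'"
    if "keep {rX, rY, rBoth, rSkip} r r1" "r1 rBoth = node 0 (\<delta> p a) (\<delta> q a)"
      "r1 rSkip = node 0 p (\<delta> q a)" for r1 u'
  proof -
    have "built es A r1 m" by (rule built_cong[OF b that(1)]) auto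
    moreover have "length control_moves = 12" "\<And>c b. (c, b) \<in> set control_moves \<Longrightarrow> c < 6"
      unfolding control_moves_def by auto
    moreover have "r1 rCell = node 0 p q" using that(1) r unfolding keep_def by simp
    ultimately have "wp W (block (map (link ctl) control_moves))
      (\<lambda>r' m' u''. built (es @ map (edge p q a) control_moves) A r' m' \<and> keep {rX, rY, rFree} r1 r' \<and>
        u'' \<le> u' + 1 + 10 * length control_moves) r1 m u'"
      using len that by (intro links_spec[OF _ _ _ pq]) auto
    then show ?thesis
      unfolding letter_edges_def by (rule wp_conseq) (auto simp: \<open>length control_moves = 12\<close>)
  qed
  have fin: "wp W (block [Add rA rA rOne]) (\<lambda>r' m' u'. built (es @ letter_edges p q a) A r' m' \<and>
     keep {rX, rY, rFree, rA, rBoth, rSkip} r r' \<and> r' rA = Suc a \<and> u' \<le> u + 131) r' m' u'"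
    if "built (es @ letter_edges p q a) A r' m'" "keep {rX, rY, rFree} r1 r'"
      "keep {rX, rY, rBoth, rSkip} r r1" "u' \<le> u + 129" for r1 r' m' u'
  proof -
    have "built (es @ letter_edges p q a) A (r'(rA := Suc a)) m'"
      by (rule built_cong[OF that(1), of "{rA}"]) (auto simp: keep_def)
    then show ?thesis
      using that r bounds built_regs[OF that(1)] by (auto simp: wp_simps keep_def)
  qed
  have "wp W (letter_body ctl) Q r m u"
    if "\<And>r1 u'. keep {rX, rY, rBoth, rSkip} r r1 \<Longrightarrow> r1 rBoth = node 0 (\<delta> p a) (\<delta> q a) \<Longrightarrow>
      r1 rSkip = node 0 p (\<delta> q a) \<Longrightarrow> u' \<le> u + 8 \<Longrightarrow>
      wp W (block (map (link ctl) control_moves)) (wp W (block [Add rA rA rOne]) Q) r1 m u'" for Q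
    unfolding letter_body_def
    apply (simp only: wp_block_Cons[of _ "Add _ _ _"] wp_block_Cons[of _ "Load _ _"] wp_block_Cons[of _ "block _"] wp_Add wp_Load)
    apply (simp only: fun_upd_apply rr r)
    apply (simp only: mem bounds r rr fun_upd_apply simp_thms num.simps numeral_eq_iff if_False if_True)
    apply (rule that)
    apply (simp_all add: keep_def node_def)
    done
  then show ?thesis
    by this (rule wp_conseq[OF links], auto intro: fin)
qed

lemma letters_spec:
  assumes b: "built es A r m" and len: "length es + k * 12 \<le> E" and pq: "p < n" "q < n"
    and r: "r rCell = node 0 p q" "r rLine = B + p * n" "r rA = 0"
      "r rRowP = 3 + n + p * k" "r rRowQ = 3 + n + q * k"
  shows "wp W (WhileLess rA rK (letter_body ctl)) (\<lambda>r' m' u'. built (es @ pair_edges p q) A r' m' \<and>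
     keep {rX, rY, rFree, rA, rBoth, rSkip} r r' \<and> u' \<le> u + 1 + k * 132) r m u"
proof -
  define J where "J i r' m' u' \<longleftrightarrow> built (es @ concat (map (letter_edges p q) [0..<i])) A r' m' \<and>
     keep {rX, rY, rFree, rA, rBoth, rSkip} r r' \<and> r' rA = i \<and> u' \<le> u + i * 132" for i r' m' u'
  show ?thesis
  proof (rule wp_for[where J = J and a = 0 and n = k])
    show "J 0 r m u" unfolding J_def using b r by (simp add: keep_def)
    show "r' rA = 0 + i \<and> r' rK = 0 + k" if "J i r' m' u'" for i r' m' u'
      using that built_regs[of _ A r' m'] unfolding J_def by auto
    show "wp W (letter_body ctl) (J (Suc i)) r' m' (u' + 1)" if i: "i < k" and J: "J i r' m' u'" for i r' m' u'
    proof -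
      have b': "built (es @ concat (map (letter_edges p q) [0..<i])) A r' m'"
        and kp: "keep {rX, rY, rFree, rA, rBoth, rSkip} r r'"
        and ri: "r' rA = i" and t: "u' \<le> u + i * 132"
        using J unfolding J_def by auto
      have "Suc i * 12 \<le> k * 12" using i by (intro mult_le_mono) auto
      then have "length (es @ concat (map (letter_edges p q) [0..<i])) + 12 \<le> E"
        using len unfolding length_append length_pair_edges by simp
      then show ?thesis
        by (rule wp_conseq[OF letter_body_spec[OF b' _ pq i]])
           (use kp r ri t in \<open>auto simp: keep_def J_def\<close>)
    qed
    show "built (es @ pair_edges p q) A r' m' \<and>
       keep {rX, rY, rFree, rA, rBoth, rSkip} r r' \<and> u' + 1 \<le> u + 1 + k * 132"
      if "J k r' m' u'" for r' m' u'
      using that unfolding J_def pair_edges_def by auto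
  qed
qed

lemma marks_spec:
  assumes "built es A r m" "length es \<le> E" "p < n" "q < n" "r rCell = node 0 p q" "set cs \<subseteq> {..<6}"
  shows "wp W (block (map mark cs)) (\<lambda>r' m' u'. built es (A \<union> (\<lambda>c. node c p q) ` set cs) r' m' \<and>
     keep {rX} r r' \<and> u' \<le> u + 1 + 4 * length cs) r m u"
  using assms
proof (induction cs arbitrary: A r m u)
  case Nil
  then show ?case by (simp add: wp_block_Nil keep_def)
next
  case (Cons c cs)
  note rr = built_regs[OF Cons.prems(1)]
  have c: "c < 6" using Cons.prems by simp
  have V: "node c p q \<in> V" using c Cons.prems by (intro node_in)
  have eq: "node 0 p q + c * (n * n) = node c p q" unfolding node_def by simp
  have bounds: "node c p q \<le> W" "node c p q + N \<le> W" using V layout(4,6) by auto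
  let ?m = "m(node c p q + N := 1)" and ?r = "r(rX := node c p q + N)"
  have b: "built es (insert (node c p q) A) ?r ?m"
  proof -
    have k: "keep {rX} r ?r" by (simp add: keep_def)
    have "built es (insert (node c p q) A) r ?m"
      unfolding built_def
    proof (intro conjI ballI allI impI)
      fix v assume v: "v \<in> V"
      have "?m v = m v" using v V by auto
      moreover have "chain H (H + 2 * length es) m (m v) (sources es v)"
        using Cons.prems(1) v unfolding built_def by blast
      moreover have "node c p q + N < H" using V layout(4) by simp
      ultimately show "chain H (H + 2 * length es) ?m (?m v) (sources es v)"
        by (auto intro: chain_cong[where m = m and hi = "H + 2 * length es"])
      show "?m (v + N) = (if v \<in> insert (node c p q) A then 1 else 0)"
        using Cons.prems(1) v unfolding built_def by auto
    qed (use Cons.prems(1) V in \<open>auto simp: built_def\<close>)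
    then show ?thesis by (rule built_cong[OF _ k]) auto
  qed
  have "wp W (block (map mark cs)) (\<lambda>r' m' u'.
     built es (insert (node c p q) A \<union> (\<lambda>c. node c p q) ` set cs) r' m' \<and>
     keep {rX} ?r r' \<and> u' \<le> Suc (Suc (Suc (Suc u))) + 1 + 4 * length cs) ?r ?m (Suc (Suc (Suc (Suc u))))"
    by (rule Cons.IH[OF b]) (use Cons.prems in auto)
  then have "wp W (block (map mark cs)) (\<lambda>r' m' u'.
     built es (A \<union> (\<lambda>c. node c p q) ` set (c # cs)) r' m' \<and>
     keep {rX} r r' \<and> u' \<le> u + 1 + 4 * length (c # cs)) ?r ?m (Suc (Suc (Suc (Suc u))))"
    by (rule wp_conseq) (auto simp: keep_def)
  then show ?case
    using bounds c unfolding list.map wp_block_Cons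
    by (simp add: mark_def wp_simps rr Cons.prems(5) eq)
qed

lemma pair_body_spec:
  assumes b: "built es A r m" and len: "length es + k * 12 \<le> E" and pq: "p < n" "q < n"
    and r: "r rCell = node 0 p q" "r rLine = B + p * n" "r rRowP = 3 + n + p * k"
      "r rRowQ = 3 + n + q * k" "r rAccQ = 3 + q" "r rQ = q" "r rFlagP = (if p \<in> Acc then 1 else 0)"
  shows "wp W (pair_body ctl accs) (\<lambda>r' m' u'. built (es @ pair_edges p q) (A \<union> marks p q) r' m' \<and>
     keep {rX, rY, rFree, rA, rBoth, rSkip, rFlagQ, rQ, rRowQ, rAccQ, rCell} r r' \<and>
     r' rQ = Suc q \<and> r' rRowQ = 3 + n + Suc q * k \<and> r' rAccQ = 3 + Suc q \<and>
     r' rCell = Suc (node 0 p q) \<and> u' \<le> u + 35 + k * 132) r m u"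
proof -
  note rr = built_regs[OF b]
  let ?f = "if q \<in> Acc then 1 else 0 :: nat"
  let ?r = "r(rFlagQ := ?f)"
  have mq: "m (3 + q) = ?f" using built_mem[OF b] acc_table pq layout(1,2) by simp
  have b1: "built es A ?r m" by (rule built_cong[OF b, of "{rFlagQ}"]) (auto simp: keep_def)
  have "set accs \<subseteq> {..<6}" using accs by auto
  \<comment> \<open>28 = 1 + 2 + 25: the load, two tests, and at most six marks of 4 units each with
    a closing \<open>Skip\<close>.\<close>
  have marks: "wp W (IfLess rZero rFlagP (IfLess rZero rFlagQ (block (map mark accs)) Skip) Skip)
      (\<lambda>r' m' u'. built es (A \<union> marks p q) r' m' \<and> keep {rX} ?r r' \<and> u' \<le> u + 28) ?r m (u + 1)"
  proof (cases "p \<in> Acc \<and> q \<in> Acc")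
    case True
    have "wp W (block (map mark accs)) (\<lambda>r' m' u'. built es (A \<union> (\<lambda>c. node c p q) ` set accs) r' m' \<and>
       keep {rX} ?r r' \<and> u' \<le> Suc (Suc (Suc u)) + 1 + 4 * length accs) ?r m (Suc (Suc (Suc u)))"
      by (rule marks_spec[OF b1]) (use len pq r \<open>set accs \<subseteq> _\<close> in auto)
    then have "wp W (block (map mark accs)) (\<lambda>r' m' u'. built es (A \<union> marks p q) r' m' \<and>
       keep {rX} ?r r' \<and> u' \<le> u + 28) ?r m (Suc (Suc (Suc u)))"
      by (rule wp_conseq) (use accs(2) True in \<open>auto simp: marks_def\<close>)
    then show ?thesis using True r rr by (simp add: wp_If)
  next
    case False
    then have "marks p q = {}" unfolding marks_def by auto
    then show ?thesis using False r rr b1 by (auto simp: wp_simps keep_def)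
  qed
  have tail: "wp W (block [Add rQ rQ rOne, Add rRowQ rRowQ rK, Add rAccQ rAccQ rOne, Add rCell rCell rOne])
    (\<lambda>r' m' u'. built (es @ pair_edges p q) (A \<union> marks p q) r' m' \<and>
     keep {rX, rY, rFree, rA, rBoth, rSkip, rFlagQ, rQ, rRowQ, rAccQ, rCell} r r' \<and>
     r' rQ = Suc q \<and> r' rRowQ = 3 + n + Suc q * k \<and> r' rAccQ = 3 + Suc q \<and>
     r' rCell = Suc (node 0 p q) \<and> u' \<le> u + 35 + k * 132) r' m' u'"
    if b': "built (es @ pair_edges p q) (A \<union> marks p q) r' m'"
      and kp: "keep {rX, rY, rFree, rA, rBoth, rSkip, rFlagQ} r r'" and t: "u' \<le> u + 30 + k * 132" for r' m' u'
  proof -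
    note rr' = built_regs[OF b']
    have "node 0 p q \<in> V" using pq by (intro node_in) auto
    moreover have "Suc q * k \<le> n * k" using pq by (intro mult_le_mono) auto
    ultimately have bounds: "Suc (node 0 p q) \<le> W" "3 + n + q * k + k \<le> W" "Suc (3 + q) \<le> W" "Suc q \<le> W"
      using layout(1,2,4,6) pq by auto
    have "built (es @ pair_edges p q) (A \<union> marks p q)
       (r'(rQ := Suc q, rRowQ := 3 + n + q * k + k, rAccQ := Suc (3 + q), rCell := Suc (node 0 p q))) m'"
      by (rule built_cong[OF b', of "{rQ, rRowQ, rAccQ, rCell}"]) (auto simp: keep_def)
    then show ?thesis
      using bounds kp t r by (simp add: wp_simps rr' keep_def)
  qed
  have letters: "wp W (Const rA 0) (wp W (WhileLess rA rK (letter_body ctl))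
      (wp W (block [Add rQ rQ rOne, Add rRowQ rRowQ rK, Add rAccQ rAccQ rOne, Add rCell rCell rOne])
       (\<lambda>r' m' u'. built (es @ pair_edges p q) (A \<union> marks p q) r' m' \<and>
     keep {rX, rY, rFree, rA, rBoth, rSkip, rFlagQ, rQ, rRowQ, rAccQ, rCell} r r' \<and>
     r' rQ = Suc q \<and> r' rRowQ = 3 + n + Suc q * k \<and> r' rAccQ = 3 + Suc q \<and>
     r' rCell = Suc (node 0 p q) \<and> u' \<le> u + 35 + k * 132))) r' m' u'"
    if b': "built es (A \<union> marks p q) r' m'" and kp: "keep {rX} ?r r'" and t: "u' \<le> u + 28" for r' m' u'
  proof -
    have b2: "built es (A \<union> marks p q) (r'(rA := 0)) m'"
      by (rule built_cong[OF b', of "{rA}"]) (auto simp: keep_def)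
    show ?thesis
      unfolding wp_Const
    proof (intro conjI, simp, rule wp_conseq[OF letters_spec[OF b2 len pq]], goal_cases)
      case (6 r'' m'' u'')
      then show ?case using kp t by (intro tail) (auto simp: keep_def)
    qed (use r kp in \<open>auto simp: keep_def\<close>)
  qed
  show ?thesis
    unfolding pair_body_def wp_block_Cons[of _ "Load _ _"] wp_Load
    unfolding r mq wp_block_Cons[of _ "IfLess _ _ _ _"]
    by (rule wp_conseq[OF marks]) (simp add: wp_block_Cons_eq[of _ "Const _ _"] wp_block_Cons_eq[of _ "WhileLess _ _ _"] letters[simplified])
qed

lemma row_body_spec:
  assumes b: "built es A r m" and len: "length es + n * (k * 12) \<le> E" and p: "p < n"
    and r: "r rCell = node 0 p 0" "r rLine = B + p * n" "r rRowP = 3 + n + p * k" "r rAccP = 3 + p" "r rP = p"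
  shows "wp W (row_body ctl accs) (\<lambda>r' m' u'. built (es @ row_edges p) (A \<union> (\<Union>q<n. marks p q)) r' m' \<and>
     r' rCell = node 0 (Suc p) 0 \<and> r' rLine = B + Suc p * n \<and> r' rRowP = 3 + n + Suc p * k \<and>
     r' rAccP = 3 + Suc p \<and> r' rP = Suc p \<and> u' \<le> u + 10 + n * (36 + k * 132)) r m u"
proof -
  note rr = built_regs[OF b]
  let ?f = "if p \<in> Acc then 1 else 0 :: nat"
  let ?S = "{rX, rY, rFree, rA, rBoth, rSkip, rFlagQ, rQ, rRowQ, rAccQ, rCell, rFlagP}"
  let ?post = "\<lambda>r' m' u'. built (es @ row_edges p) (A \<union> (\<Union>q<n. marks p q)) r' m' \<and>
     r' rCell = node 0 (Suc p) 0 \<and> r' rLine = B + Suc p * n \<and> r' rRowP = 3 + n + Suc p * k \<and>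
     r' rAccP = 3 + Suc p \<and> r' rP = Suc p \<and> u' \<le> u + 10 + n * (36 + k * 132)"
  let ?r = "r(rFlagP := ?f, rQ := 0, rRowQ := 3 + n, rAccQ := 3)"
  let ?tail = "[Add rP rP rOne, Add rRowP rRowP rK, Add rAccP rAccP rOne, Add rLine rLine rN]"
  have mp: "m (3 + p) = ?f" using built_mem[OF b] acc_table p layout(1,2) by simp
  define J where "J i r' m' u' \<longleftrightarrow>
     built (es @ concat (map (pair_edges p) [0..<i])) (A \<union> (\<Union>q<i. marks p q)) r' m' \<and>
     keep ?S r r' \<and> r' rFlagP = ?f \<and> r' rQ = i \<and> r' rRowQ = 3 + n + i * k \<and> r' rAccQ = 3 + i \<and>
     r' rCell = node 0 p i \<and> u' \<le> u + 4 + i * (36 + k * 132)" for i r' m' u'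
  have tail: "wp W (block ?tail) ?post r' m' (u' + 1)" if J: "J n r' m' u'" for r' m' u'
  proof -
    \<comment> \<open>\<open>rCell\<close> is not reset between rows, because
      \<open>node 0 p n\<close> and \<open>node 0 (Suc p) 0\<close> are the same address.\<close>
    have b': "built (es @ row_edges p) (A \<union> (\<Union>q<n. marks p q)) r' m'" and kp: "keep ?S r r'"
      and cell: "r' rCell = node 0 p n" and t: "u' \<le> u + 4 + n * (36 + k * 132)"
      using J unfolding J_def row_edges_def by auto
    note rr' = built_regs[OF b']
    have "Suc p * k \<le> n * k" "Suc p * n \<le> n * n" using p by (intro mult_le_mono; simp)+
    then have bounds: "3 + n + p * k + k \<le> W" "B + p * n + n \<le> W" "Suc (3 + p) \<le> W" "Suc p \<le> W"
      using layout p by auto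
    have "built (es @ row_edges p) (A \<union> (\<Union>q<n. marks p q))
       (r'(rP := Suc p, rRowP := 3 + n + p * k + k, rAccP := Suc (3 + p), rLine := B + p * n + n)) m'"
      by (rule built_cong[OF b', of "{rP, rRowP, rAccP, rLine}"]) (auto simp: keep_def)
    moreover have "r' rP = p" "r' rRowP = 3 + n + p * k" "r' rAccP = 3 + p" "r' rLine = B + p * n"
      using kp r unfolding keep_def by auto
    ultimately show ?thesis
      using bounds t cell by (simp add: wp_simps rr' node_def)
  qed
  have loop: "wp W (WhileLess rQ rN (pair_body ctl accs)) (wp W (block ?tail) ?post) r1 m u1"
    if J0: "J 0 r1 m u1" for r1 u1
  proof (rule wp_for[where J = J and a = 0 and n = n])
    show "J 0 r1 m u1" by (rule J0)
    show "r' rQ = 0 + i \<and> r' rN = 0 + n" if "J i r' m' u'" for i r' m' u'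
      using that built_regs(3)[of _ _ r' m'] unfolding J_def by auto
    show "wp W (block ?tail) ?post r' m' (u' + 1)" if "J n r' m' u'" for r' m' u'
      using that by (rule tail)
    show "wp W (pair_body ctl accs) (J (Suc i)) r' m' (u' + 1)"
      if i: "i < n" and J: "J i r' m' u'" for i r' m' u'
    proof -
      have b': "built (es @ concat (map (pair_edges p) [0..<i])) (A \<union> (\<Union>q<i. marks p q)) r' m'"
        and kp: "keep ?S r r'"
        and ri: "r' rFlagP = ?f" "r' rQ = i" "r' rRowQ = 3 + n + i * k" "r' rAccQ = 3 + i"
          "r' rCell = node 0 p i"
        and t: "u' \<le> u + 4 + i * (36 + k * 132)"
        using J unfolding J_def by auto
      have "Suc i * (k * 12) \<le> n * (k * 12)" using i by (intro mult_le_mono) auto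
      then have l: "length (es @ concat (map (pair_edges p) [0..<i])) + k * 12 \<le> E"
        using len unfolding length_append length_row_edges by simp
      show ?thesis
      proof (rule wp_conseq[OF pair_body_spec[OF b' l p i]], goal_cases)
        case (8 r'' m'' u'')
        then show ?case
          using kp t ri unfolding J_def by (auto simp: keep_def lessThan_Suc Un_ac node_def)
      qed (use kp ri r in \<open>auto simp: keep_def\<close>)
    qed
  qed
  have J0: "J 0 ?r m u1" if "u1 \<le> u + 4" for u1
  proof -
    have "built es A ?r m" by (rule built_cong[OF b, of "{rFlagP, rQ, rRowQ, rAccQ}"]) (auto simp: keep_def)
    then show ?thesis using r that unfolding J_def by (auto simp: keep_def)
  qed
  have "3 + n \<le> W" "3 \<le> W" using layout by auto
  then show ?thesis
    unfolding row_body_def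
    apply (simp only: wp_block_Cons[of _ "Load _ _"] wp_block_Cons[of _ "Const _ _"]
      wp_block_Cons[of _ "WhileLess _ _ _"] wp_Load wp_Const wp_block_Cons[of _ "Add rRowQ _ _"] wp_Add)
    apply (simp only: r mp rr fun_upd_apply num.simps numeral_eq_iff if_False if_True)
    apply (intro conjI)
    apply simp
    apply simp
    apply simp
    apply (simp only: add_0_right)
    apply (rule loop, rule J0)
    apply simp
    done
qed

lemma build_spec:
  assumes b: "built [] {} r m"
  shows "wp W (build ctl accs) (\<lambda>r' m' u'. built all_edges (\<Union>p<n. \<Union>q<n. marks p q) r' m' \<and>
     u' \<le> u + 7 + n * (11 + n * (36 + k * 132))) r m u"
proof -
  note rr = built_regs[OF b]
  let ?r = "r(rP := 0, rRowP := 3 + n, rAccP := 3, rLine := B, rCell := B)"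
  let ?post = "\<lambda>r' m' u'. built all_edges (\<Union>p<n. \<Union>q<n. marks p q) r' m' \<and>
     u' \<le> u + 7 + n * (11 + n * (36 + k * 132))"
  define J where "J i r' m' u' \<longleftrightarrow>
     built (concat (map row_edges [0..<i])) (\<Union>p<i. \<Union>q<n. marks p q) r' m' \<and>
     r' rCell = node 0 i 0 \<and> r' rLine = B + i * n \<and> r' rRowP = 3 + n + i * k \<and>
     r' rAccP = 3 + i \<and> r' rP = i \<and> u' \<le> u + 5 + i * (11 + n * (36 + k * 132))" for i r' m' u'
  have loop: "wp W (WhileLess rP rN (row_body ctl accs)) (wp W (block []) ?post) r1 m u1"
    if J0: "J 0 r1 m u1" for r1 u1
  proof (rule wp_for[where J = J and a = 0 and n = n])
    show "J 0 r1 m u1" by (rule J0)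
    show "r' rP = 0 + i \<and> r' rN = 0 + n" if "J i r' m' u'" for i r' m' u'
      using that built_regs(3)[of _ _ r' m'] unfolding J_def by auto
    show "wp W (block []) ?post r' m' (u' + 1)" if "J n r' m' u'" for r' m' u'
      using that unfolding J_def all_edges_def wp_block_Nil by auto
    show "wp W (row_body ctl accs) (J (Suc i)) r' m' (u' + 1)"
      if i: "i < n" and J: "J i r' m' u'" for i r' m' u'
    proof -
      have b': "built (concat (map row_edges [0..<i])) (\<Union>p<i. \<Union>q<n. marks p q) r' m'"
        and ri: "r' rCell = node 0 i 0" "r' rLine = B + i * n" "r' rRowP = 3 + n + i * k"
          "r' rAccP = 3 + i" "r' rP = i"
        and t: "u' \<le> u + 5 + i * (11 + n * (36 + k * 132))"
        using J unfolding J_def by auto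
      have "Suc i * (n * (k * 12)) \<le> n * (n * (k * 12))" using i by (intro mult_le_mono) auto
      then have l: "length (concat (map row_edges [0..<i])) + n * (k * 12) \<le> E"
        unfolding length_edges layout(5) by simp
      show ?thesis
        by (rule wp_conseq[OF row_body_spec[OF b' l i ri]])
           (use t in \<open>auto simp: J_def lessThan_Suc Un_ac\<close>)
    qed
  qed
  have J0: "J 0 ?r m u1" if "u1 \<le> u + 5" for u1
  proof -
    have "built [] {} ?r m"
      by (rule built_cong[OF b, of "{rP, rRowP, rAccP, rLine, rCell}"]) (auto simp: keep_def)
    then show ?thesis using that unfolding J_def by (auto simp: node_def)
  qed
  have "3 + n \<le> W" "3 \<le> W" "B \<le> W" using layout by auto
  then show ?thesis
    unfolding build_def
    by (simp only: wp_block_Cons[of _ "Const _ _"] wp_block_Cons[of _ "Add _ _ _"]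
          wp_block_Cons[of _ "WhileLess _ _ _"] wp_Const wp_Add rr fun_upd_apply num.simps
          numeral_eq_iff if_False if_True add_0_right)
       (intro conjI, simp, simp, simp, simp, simp, rule loop, rule J0, simp)
qed

end

section \<open>Correctness of the two closures\<close>

text \<open>Double counting: the edges into \<open>S\<close>, stored at their targets, are recounted
  by their source.\<close>

lemma deg_sources:
  assumes "finite S"
  shows "deg (sources es) S v = length (filter (\<lambda>e. fst e = v \<and> snd e \<in> S) es)"
proof (induction es)
  case Nil
  then show ?case by (simp add: deg_def sources_def)
next
  case (Cons e es)
  have "count_list (sources (e # es) u) v =
      (if u = snd e then (if fst e = v then 1 else 0) else 0) + count_list (sources es u) v" for u
    by (simp add: sources_def)
  then have "deg (sources (e # es)) S v = (\<Sum>u\<in>S. if u = snd e then (if fst e = v then 1 else 0) else 0)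
      + deg (sources es) S v"
    unfolding deg_def by (simp add: sum.distrib)
  then show ?case using Cons assms by (simp add: sum.delta)
qed

text \<open>Each edge is stored in the list of one target only. This makes the total scanning time
  linear in the number of edges.\<close>

lemma sum_length_sources: "finite S \<Longrightarrow> (\<Sum>v\<in>S. length (sources es v)) \<le> length es"
proof (induction es)
  case Nil
  then show ?case by (simp add: sources_def)
next
  case (Cons e es)
  have "length (sources (e # es) u) = (if u = snd e then 1 else 0) + length (sources es u)" for u
    by (simp add: sources_def)
  then show ?case using Cons by (simp add: sum.distrib sum.delta)
qed

text \<open>This turns a numerical threshold into a universal statement: a selection as long as the
  whole list omits nothing. Multiplicities do no harm.\<close>

lemma length_filter_conj_eq_iff:
  "length (filter P xs) \<le> length (filter (\<lambda>x. P x \<and> Q x) xs) \<longleftrightarrow> (\<forall>x\<in>set xs. P x \<longrightarrow> Q x)"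
proof (induction xs)
  case (Cons x xs)
  have "length (filter (\<lambda>x. P x \<and> Q x) xs) \<le> length (filter P xs)"
    by (induction xs) auto
  then show ?case using Cons by (cases "P x"; cases "Q x") simp_all
qed simp

lemma length_filter_concat_upt:
  "length (filter P (concat (map f [0..<n]))) = (\<Sum>i<n. length (filter P (f i)))"
  by (induction n) auto

context build_memory
begin

lemma node_inj:
  assumes "node c p q = node c' p' q'" "p < n" "q < n" "p' < n" "q' < n"
  shows "c = c' \<and> p = p' \<and> q = q'"
proof -
  have lt: "p * n + q < n * n" if "p < n" "q < n" for p q
  proof -
    have "p * n + q < Suc p * n" using that by simp
    also have "\<dots> \<le> n * n" using that by (intro mult_le_mono) auto
    finally show ?thesis .
  qed
  have eq: "p * n + q + c * (n * n) = p' * n + q' + c' * (n * n)" using assms(1) unfolding node_def by simp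
  have "(p * n + q + c * (n * n)) div (n * n) = c" "(p' * n + q' + c' * (n * n)) div (n * n) = c'"
    using lt[OF assms(2,3)] lt[OF assms(4,5)] assms(2) by simp_all
  then have c: "c = c'" using eq by simp
  then have eq2: "p * n + q = p' * n + q'" using eq by simp
  have "(p * n + q) div n = p" "(p' * n + q') div n = p'" using assms by simp_all
  then show ?thesis using eq2 c by simp
qed

definition step :: "nat \<Rightarrow> nat \<Rightarrow> nat \<Rightarrow> bool \<Rightarrow> nat \<Rightarrow> nat" where
  "step c p q b a = node (ctl c b) (if b then \<delta> p a else p) (\<delta> q a)"

lemma set_all_edges:
  "set all_edges = {(node c p q, step c p q b a) | c p q b a. c < 6 \<and> p < n \<and> q < n \<and> a < k}"
proof -
  have "set control_moves = {..<6} \<times> UNIV" unfolding control_moves_def by auto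
  then have "set all_edges = (\<Union>p<n. \<Union>q<n. \<Union>a<k. edge p q a ` ({..<6} \<times> UNIV))"
    unfolding all_edges_def row_edges_def pair_edges_def letter_edges_def
    by (simp add: atLeast0LessThan)
  then have *: "e \<in> set all_edges \<longleftrightarrow> (\<exists>p<n. \<exists>q<n. \<exists>a<k. \<exists>c<6. \<exists>b. e = edge p q a (c, b))" for e
    by (simp only: UN_iff image_iff lessThan_iff Bex_def mem_Times_iff UNIV_I) (metis fst_conv prod.collapse)
  show ?thesis
  proof (intro set_eqI)
    fix e
    show "e \<in> set all_edges \<longleftrightarrow>
        e \<in> {(node c p q, step c p q b a) | c p q b a. c < 6 \<and> p < n \<and> q < n \<and> a < k}"
      unfolding * edge_def step_def mem_Collect_eq prod.case by blast
  qed
qed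

text \<open>Parallel edges are counted separately, so all nodes have the same out-degree, and the
  single threshold \<open>2 * k\<close> means that all successors lie in the set.\<close>

lemma length_out_edges:
  assumes "c < 6" "p < n" "q < n"
  shows "length (filter (\<lambda>e. fst e = node c p q) all_edges) = 2 * k"
proof -
  have 1: "length (filter (\<lambda>e. fst e = node c p q) (letter_edges p' q' a)) =
      (if p' = p then if q' = q then 2 else 0 else 0)" if "p' < n" "q' < n" for p' q' a
  proof -
    have "fst (edge p' q' a cb) = node c p q \<longleftrightarrow> fst cb = c \<and> p' = p \<and> q' = q" for cb
      using node_inj[of "fst cb" p' q' c p q] that assms unfolding edge_def by (auto split: prod.splits)
    then have "length (filter (\<lambda>e. fst e = node c p q) (letter_edges p' q' a)) =
        length (filter (\<lambda>cb. fst cb = c \<and> p' = p \<and> q' = q) control_moves)"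
      unfolding letter_edges_def by (simp add: filter_map comp_def)
    also have "\<dots> = card ({cb. fst cb = c \<and> p' = p \<and> q' = q} \<inter> set control_moves)"
      unfolding control_moves_def by (intro distinct_length_filter distinct_product) auto
    also have "{cb. fst cb = c \<and> p' = p \<and> q' = q} \<inter> set control_moves =
        (if p' = p \<and> q' = q then {c} \<times> UNIV else {})"
      using assms(1) unfolding control_moves_def by auto
    also have "card \<dots> = (if p' = p then if q' = q then 2 else 0 else 0)"
      by (simp add: card_UNIV_bool del: insert_Times_insert)
    finally show ?thesis .
  qed
  have 2: "length (filter (\<lambda>e. fst e = node c p q) (pair_edges p' q')) =
      (if p' = p then if q' = q then 2 * k else 0 else 0)" if "p' < n" "q' < n" for p' q'
    unfolding pair_edges_def length_filter_concat_upt using that by (simp add: 1)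
  have 3: "length (filter (\<lambda>e. fst e = node c p q) (row_edges p')) = (if p' = p then 2 * k else 0)"
    if "p' < n" for p'
  proof -
    have "length (filter (\<lambda>e. fst e = node c p q) (row_edges p')) =
       (\<Sum>q'<n. if p' = p then if q' = q then 2 * k else 0 else 0)"
      unfolding row_edges_def length_filter_concat_upt using that by (intro sum.cong) (auto simp: 2)
    also have "\<dots> = (if p' = p then 2 * k else 0)" using assms by (simp add: sum.delta)
    finally show ?thesis .
  qed
  have "length (filter (\<lambda>e. fst e = node c p q) all_edges) = (\<Sum>p'<n. if p' = p then 2 * k else 0)"
    unfolding all_edges_def length_filter_concat_upt by (intro sum.cong) (auto simp: 3)
  then show ?thesis using assms by (simp add: sum.delta)
qed

lemma out_edge_iff:
  assumes "c < 6" "p < n" "q < n"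
  shows "(node c p q, v) \<in> set all_edges \<longleftrightarrow> (\<exists>b. \<exists>a<k. v = step c p q b a)"
proof
  assume "(node c p q, v) \<in> set all_edges"
  then obtain c' p' q' b a where *: "node c p q = node c' p' q'" "v = step c' p' q' b a" "p' < n" "q' < n" "a < k"
    unfolding set_all_edges by blast
  then show "\<exists>b. \<exists>a<k. v = step c p q b a" using node_inj[OF *(1)] assms by blast
next
  assume "\<exists>b. \<exists>a<k. v = step c p q b a"
  then show "(node c p q, v) \<in> set all_edges" unfolding set_all_edges using assms by blast
qed

lemma deg_pos_iff:
  assumes "finite S" "c < 6" "p < n" "q < n"
  shows "1 \<le> deg (sources all_edges) S (node c p q) \<longleftrightarrow> (\<exists>b. \<exists>a<k. step c p q b a \<in> S)"
proof -
  have "1 \<le> deg (sources all_edges) S (node c p q) \<longleftrightarrow>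
      (\<exists>e\<in>set all_edges. fst e = node c p q \<and> snd e \<in> S)"
    unfolding deg_sources[OF assms(1)] by (simp add: Suc_le_eq filter_empty_conv)
  also have "\<dots> \<longleftrightarrow> (\<exists>b. \<exists>a<k. step c p q b a \<in> S)"
    using out_edge_iff[OF assms(2-4)] by (metis fst_conv prod.collapse snd_conv)
  finally show ?thesis .
qed

lemma deg_full_iff:
  assumes "finite S" "c < 6" "p < n" "q < n"
  shows "2 * k \<le> deg (sources all_edges) S (node c p q) \<longleftrightarrow> (\<forall>b. \<forall>a<k. step c p q b a \<in> S)"
proof -
  have "2 * k \<le> deg (sources all_edges) S (node c p q) \<longleftrightarrow>
      (\<forall>e\<in>set all_edges. fst e = node c p q \<longrightarrow> snd e \<in> S)"
    unfolding deg_sources[OF assms(1)] length_out_edges[OF assms(2-4), symmetric]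
    by (rule length_filter_conj_eq_iff)
  also have "\<dots> \<longleftrightarrow> (\<forall>b. \<forall>a<k. step c p q b a \<in> S)"
    using out_edge_iff[OF assms(2-4)] by (metis fst_conv prod.collapse snd_conv)
  finally show ?thesis .
qed

section \<open>Languages of the nodes and the two least sets\<close>

fun accepts :: "nat \<Rightarrow> nat \<Rightarrow> nat \<Rightarrow> (bool \<times> nat) list \<Rightarrow> bool" where
  "accepts c p q [] \<longleftrightarrow> c \<in> set accs \<and> p \<in> Acc \<and> q \<in> Acc"
| "accepts c p q ((b, a) # z) \<longleftrightarrow> a < k \<and> accepts (ctl c b) (if b then \<delta> p a else p) (\<delta> q a) z"

text \<open>Separates the product run into its components: the control on the pattern, the copy from
  \<open>p\<close> on the letters of \<open>v\<close>, the copy from \<open>q\<close> on all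
  letters, which form \<open>w\<close>.\<close>

lemma accepts_iff:
  "accepts c p q z \<longleftrightarrow> set (map snd z) \<subseteq> {..<k} \<and> foldl ctl c (map fst z) \<in> set accs \<and>
     foldl \<delta> p (map snd (filter fst z)) \<in> Acc \<and> foldl \<delta> q (map snd z) \<in> Acc"
  by (induction c p q z rule: accepts.induct) auto

lemma in_marks_iff:
  assumes "c < 6" "p < n" "q < n"
  shows "node c p q \<in> (\<Union>p<n. \<Union>q<n. marks p q) \<longleftrightarrow> accepts c p q []"
proof
  assume "node c p q \<in> (\<Union>p<n. \<Union>q<n. marks p q)"
  then obtain c' p' q' where *: "node c p q = node c' p' q'" "p' < n" "q' < n" "accepts c' p' q' []"
    unfolding marks_def by (auto split: if_splits)
  then show "accepts c p q []" using node_inj[OF *(1)] assms by blast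
next
  assume "accepts c p q []"
  then have "node c p q \<in> marks p q" unfolding marks_def by simp
  then show "node c p q \<in> (\<Union>p<n. \<Union>q<n. marks p q)" using assms by blast
qed

text \<open>From left to right by minimality, as the nodes with nonempty language form a closed set;
  from right to left by induction on an accepted word, using closedness of \<open>S\<close>.\<close>

lemma nonempty_iff:
  assumes least: "least_threshold_closed (sources all_edges) V 1 (\<Union>p<n. \<Union>q<n. marks p q) S"
    and "c < 6" "p < n" "q < n"
  shows "node c p q \<in> S \<longleftrightarrow> (\<exists>z. accepts c p q z)"
proof
  let ?S = "{node c p q | c p q. c < 6 \<and> p < n \<and> q < n \<and> (\<exists>z. accepts c p q z)}"
  have sub: "?S \<subseteq> V" using node_in by blast
  then have fin: "finite ?S" by (rule finite_subset) simp
  have "threshold_closed (sources all_edges) V 1 (\<Union>p<n. \<Union>q<n. marks p q) ?S"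
    unfolding threshold_closed_def
  proof (intro conjI ballI impI sub)
    show "(\<Union>p<n. \<Union>q<n. marks p q) \<subseteq> ?S"
    proof
      fix v assume "v \<in> (\<Union>p<n. \<Union>q<n. marks p q)"
      moreover from this obtain c p q where "v = node c p q" "c < 6" "p < n" "q < n"
        using accs(1) unfolding marks_def by (auto split: if_splits)
      ultimately show "v \<in> ?S" using in_marks_iff by blast
    qed
    \<comment> \<open>The decomposition of \<open>v\<close> is read off an edge leaving it, which
      exists because the degree is positive.\<close>
    fix v assume deg: "1 \<le> deg (sources all_edges) ?S v"
    then obtain e where "e \<in> set all_edges" "fst e = v"
      unfolding deg_sources[OF fin] by (auto simp: Suc_le_eq filter_empty_conv)
    then obtain c p q where v: "v = node c p q" "c < 6" "p < n" "q < n"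
      unfolding set_all_edges by auto
    obtain b a where ba: "a < k" "step c p q b a \<in> ?S"
      using deg_pos_iff[OF fin v(2-4)] deg unfolding v(1) by blast
    then obtain c' p' q' z where *: "step c p q b a = node c' p' q'" "p' < n" "q' < n" "accepts c' p' q' z"
      by auto
    then have "c' = ctl c b \<and> p' = (if b then \<delta> p a else p) \<and> q' = \<delta> q a"
      using \<delta>[of p a] \<delta>[of q a] v ba by (intro node_inj) (auto simp: step_def)
    then have "accepts c p q ((b, a) # z)" using * ba by auto
    then show "v \<in> ?S" using v by blast
  qed
  then have "S \<subseteq> ?S" using least unfolding least_threshold_closed_def by blast
  then show "\<exists>z. accepts c p q z" if "node c p q \<in> S"
    using that node_inj assms by blast
next
  have cl: "threshold_closed (sources all_edges) V 1 (\<Union>p<n. \<Union>q<n. marks p q) S"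
    using least unfolding least_threshold_closed_def by blast
  have fin: "finite S" using cl unfolding threshold_closed_def by (meson finite_atLeastLessThan finite_subset)
  assume "\<exists>z. accepts c p q z"
  then obtain z where "accepts c p q z" by blast
  then show "node c p q \<in> S"
    using assms(2-4)
  proof (induction z arbitrary: c p q)
    case Nil
    then have "node c p q \<in> (\<Union>p<n. \<Union>q<n. marks p q)" using in_marks_iff by blast
    then show ?case using cl unfolding threshold_closed_def by blast
  next
    case (Cons ba z)
    obtain b a where ba: "ba = (b, a)" by force
    have a: "a < k" using Cons.prems ba by simp
    have "step c p q b a \<in> S"
      unfolding step_def using Cons.prems ba \<delta>[OF _ a] ctl by (intro Cons.IH) auto
    then have "1 \<le> deg (sources all_edges) S (node c p q)"
      using a deg_pos_iff[OF fin Cons.prems(2-4)] by blast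
    then show ?case using cl node_in[OF Cons.prems(2-4)] unfolding threshold_closed_def by blast
  qed
qed

text \<open>From left to right by minimality: a language is finite if all its quotients by a first
  letter are. Conversely, a node outside \<open>S\<close> is in \<open>S1\<close>, so it accepts
  some word, and it has a successor outside \<open>S\<close>; following such successors yields
  accepted words of any length.\<close>

lemma finite_iff:
  assumes S1: "\<And>c p q. c < 6 \<Longrightarrow> p < n \<Longrightarrow> q < n \<Longrightarrow> node c p q \<in> S1 \<longleftrightarrow> (\<exists>z. accepts c p q z)"
    and least: "least_threshold_closed (sources all_edges) V (2 * k) (V - S1) S"
    and "c < 6" "p < n" "q < n"
  shows "node c p q \<in> S \<longleftrightarrow> finite {z. accepts c p q z}"
proof
  \<comment> \<open>Quantifying over all codes of \<open>v\<close> replaces a proof that every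
    address in \<open>V\<close> is of the form \<open>node c p q\<close>.\<close>
  let ?S = "{v \<in> V. \<forall>c p q. c < 6 \<longrightarrow> p < n \<longrightarrow> q < n \<longrightarrow> v = node c p q \<longrightarrow> finite {z. accepts c p q z}}"
  have fin: "finite ?S" by simp
  have "threshold_closed (sources all_edges) V (2 * k) (V - S1) ?S"
    unfolding threshold_closed_def
  proof (intro conjI ballI impI)
    have "{z. accepts c p q z} = {}" if "c < 6" "p < n" "q < n" "node c p q \<notin> S1" for c p q
      using S1[OF that(1-3)] that(4) by blast
    then have "finite {z. accepts c p q z}" if "c < 6" "p < n" "q < n" "node c p q \<notin> S1" for c p q
      using that by (metis finite.emptyI)
    then show "V - S1 \<subseteq> ?S" by blast
    fix v assume v: "v \<in> V" "2 * k \<le> deg (sources all_edges) ?S v"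
    have "finite {z. accepts c p q z}" if c: "c < 6" "p < n" "q < n" "v = node c p q" for c p q
    proof -
      have succ: "step c p q b a \<in> ?S" if "a < k" for b a
        using that v deg_full_iff[OF fin c(1-3)] c(4) by blast
      have fin_succ: "finite {z. accepts (ctl c b) (if b then \<delta> p a else p) (\<delta> q a) z}" if "a < k" for b a
        using succ[OF that, of b] \<delta>[OF c(2) that] \<delta>[OF c(3) that] c ctl[of c b] unfolding step_def by auto
      define Z where "Z ba = {z. accepts (ctl c (fst ba)) (if fst ba then \<delta> p (snd ba) else p) (\<delta> q (snd ba)) z}"
        for ba :: "bool \<times> nat"
      have "finite (Z ba)" if "ba \<in> UNIV \<times> {..<k}" for ba
        unfolding Z_def by (rule fin_succ) (use that in auto)
      then have "finite ({[]} \<union> (\<Union>ba\<in>UNIV \<times> {..<k}. (#) ba ` Z ba))" by auto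
      moreover have "z \<in> {[]} \<union> (\<Union>ba\<in>UNIV \<times> {..<k}. (#) ba ` Z ba)" if "accepts c p q z" for z
      proof (cases z)
        case (Cons ba y)
        obtain b a where ba: "ba = (b, a)" by force
        have "accepts c p q ((b, a) # y)" using that unfolding Cons ba .
        then have "y \<in> Z ba" "ba \<in> UNIV \<times> {..<k}" unfolding Z_def ba accepts.simps by auto
        then show ?thesis unfolding Cons by blast
      qed simp
      then have "{z. accepts c p q z} \<subseteq> {[]} \<union> (\<Union>ba\<in>UNIV \<times> {..<k}. (#) ba ` Z ba)" by blast
      ultimately show ?thesis by (rule finite_subset[rotated])
    qed
    then show "v \<in> ?S" using v by blast
  qed auto
  then have "S \<subseteq> ?S" using least unfolding least_threshold_closed_def by blast
  then show "finite {z. accepts c p q z}" if "node c p q \<in> S" using that assms by blast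
next
  have cl: "threshold_closed (sources all_edges) V (2 * k) (V - S1) S"
    using least unfolding least_threshold_closed_def by blast
  have fin: "finite S" using cl unfolding threshold_closed_def by (meson finite_atLeastLessThan finite_subset)
  have long: "\<exists>z. accepts c p q z \<and> i \<le> length z"
    if "node c p q \<notin> S" "c < 6" "p < n" "q < n" for i c p q
    using that
  proof (induction i arbitrary: c p q)
    case 0
    then have "node c p q \<in> S1" using cl node_in unfolding threshold_closed_def by blast
    then show ?case using S1 0 by blast
  next
    case (Suc i)
    have "\<not> 2 * k \<le> deg (sources all_edges) S (node c p q)"
      using Suc.prems cl node_in[OF Suc.prems(2-4)] unfolding threshold_closed_def by blast
    then obtain b a where ba: "a < k" "step c p q b a \<notin> S"
      using deg_full_iff[OF fin Suc.prems(2-4)] by blast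
    then have "\<exists>z. accepts (ctl c b) (if b then \<delta> p a else p) (\<delta> q a) z \<and> i \<le> length z"
      using Suc.prems \<delta> ctl by (intro Suc.IH) (auto simp: step_def)
    then obtain z where "accepts (ctl c b) (if b then \<delta> p a else p) (\<delta> q a) z" "i \<le> length z" by blast
    then show ?case using ba by (intro exI[of _ "(b, a) # z"]) simp
  qed
  assume f: "finite {z. accepts c p q z}"
  show "node c p q \<in> S"
  proof (rule ccontr)
    assume "node c p q \<notin> S"
    then obtain z where "accepts c p q z" "Suc (Max (length ` {z. accepts c p q z})) \<le> length z"
      using long assms(3-5) by blast
    then show False using f by (metis Max_ge finite_imageI image_eqI mem_Collect_eq not_less_eq_eq)
  qed
qed

end

text \<open>
  A word over pairs \<open>(b, a)\<close> aligns \<open>v\<close> with \<open>w\<close>: every letter \<open>a\<close> is read in \<open>w\<close>, and those with \<open>b\<close> also in \<open>v\<close>.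
\<close>

definition aligned_from :: "(nat \<Rightarrow> bool \<Rightarrow> nat) \<Rightarrow> nat set \<Rightarrow> nat \<Rightarrow> 'a list \<Rightarrow> 'a list \<Rightarrow> bool" where
  "aligned_from ctl A c v w \<longleftrightarrow>
     (\<exists>z. map snd z = w \<and> map snd (filter fst z) = v \<and> foldl ctl c (map fst z) \<in> A)"

lemma (in build_memory) almost_free_iff:
  assumes R: "\<And>v w. R v w \<and> v \<noteq> w \<longleftrightarrow> aligned_from ctl (set accs) 0 v w"
    and L: "L = {w \<in> lists {..<k}. foldl \<delta> s w \<in> Acc}"
  shows "almost_free R L \<longleftrightarrow> (\<exists>z. accepts 0 s s z) \<and> finite {z. accepts 0 s s z}"
proof -
  let ?Z = "{z. accepts 0 s s z}"
  let ?f = "\<lambda>z::(bool \<times> nat) list. (map snd (filter fst z), map snd z)"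
  have wit: "witnesses R L = ?f ` ?Z"
  proof (intro equalityI subsetI)
    fix x assume "x \<in> witnesses R L"
    then obtain v w where x: "x = (v, w)" "v \<in> L" "w \<in> L" "R v w \<and> v \<noteq> w" unfolding witnesses_def by blast
    then obtain z where "map snd z = w" "map snd (filter fst z) = v" "foldl ctl 0 (map fst z) \<in> set accs"
      unfolding R aligned_from_def by blast
    then have "x = ?f z" "accepts 0 s s z" using x unfolding accepts_iff L by auto
    then show "x \<in> ?f ` ?Z" by blast
  next
    fix x assume "x \<in> ?f ` ?Z"
    then obtain z where z: "x = ?f z" "accepts 0 s s z" by blast
    then have "R (fst x) (snd x) \<and> fst x \<noteq> snd x" unfolding R aligned_from_def by (auto simp: accepts_iff)
    then show "x \<in> witnesses R L" using z by (force simp: witnesses_def accepts_iff L)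
  qed
  have "finite ?Z" if f: "finite (?f ` ?Z)"
  proof (rule finite_subset)
    \<comment> \<open>The second components of an alignment spell \<open>snd x\<close>, so its
      length is determined by \<open>x\<close>; over a finite alphabet this makes each fibre
      finite.\<close>
    show "?Z \<subseteq> (\<Union>x\<in>?f ` ?Z. {z. set z \<subseteq> UNIV \<times> {..<k} \<and> length z = length (snd x)})"
      by (force simp: accepts_iff)
    show "finite (\<Union>x\<in>?f ` ?Z. {z :: (bool \<times> nat) list. set z \<subseteq> UNIV \<times> {..<k} \<and> length z = length (snd x)})"
      using f by (intro finite_UN_I finite_lists_length_eq) auto
  qed
  then show ?thesis unfolding almost_free_def wit by auto
qed

section \<open>The four alignment controls\<close>

lemma aligned_from_Nil: "aligned_from ctl A c v [] \<longleftrightarrow> v = [] \<and> c \<in> A"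
  unfolding aligned_from_def by auto

text \<open>Gives a recursion on \<open>w\<close> for the relation recognised from each control
  state, on which the four correctness proofs rest.\<close>

lemma aligned_from_Cons:
  "aligned_from ctl A c v (a # w) \<longleftrightarrow>
     (\<exists>v'. v = a # v' \<and> aligned_from ctl A (ctl c True) v' w) \<or> aligned_from ctl A (ctl c False) v w"
  (is "?L \<longleftrightarrow> ?R")
proof
  assume ?L
  then obtain z where "map snd z = a # w \<and> map snd (filter fst z) = v \<and> foldl ctl c (map fst z) \<in> A"
    unfolding aligned_from_def by (rule exE)
  then have z: "map snd z = a # w" "map snd (filter fst z) = v" "foldl ctl c (map fst z) \<in> A"
    by simp_all
  obtain b y where y: "z = (b, a) # y" "map snd y = w"
    using z(1) unfolding map_eq_Cons_conv by (metis prod.collapse)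
  show ?R
  proof (cases b)
    case True
    then have "aligned_from ctl A (ctl c True) (map snd (filter fst y)) w"
      using z(3) y unfolding aligned_from_def by (intro exI[of _ y]) simp
    then show ?thesis using True z(2) y by auto
  next
    case False
    then show ?thesis using z y unfolding aligned_from_def by (intro disjI2 exI[of _ y]) simp
  qed
next
  assume ?R
  then show ?L
  proof (elim disjE exE conjE)
    fix v' assume v: "v = a # v'" "aligned_from ctl A (ctl c True) v' w"
    from v(2) obtain z where "map snd z = w \<and> map snd (filter fst z) = v' \<and> foldl ctl (ctl c True) (map fst z) \<in> A"
      unfolding aligned_from_def by (rule exE)
    then show ?L using v(1) unfolding aligned_from_def by (intro exI[of _ "(True, a) # z"]) simp
  next
    assume "aligned_from ctl A (ctl c False) v w"
    then obtain z where "map snd z = w \<and> map snd (filter fst z) = v \<and> foldl ctl (ctl c False) (map fst z) \<in> A"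
      unfolding aligned_from_def by (rule exE)
    then show ?L unfolding aligned_from_def by (intro exI[of _ "(False, a) # z"]) simp
  qed
qed

text \<open>
  With \<open>B\<close> for a letter read in both words and \<open>S\<close> for a letter skipped in \<open>v\<close>, the proper alignments are
  \<open>B\<^sup>* S\<^sup>+\<close> for prefixes, \<open>S\<^sup>+ B\<^sup>*\<close> for suffixes, \<open>S\<^sup>* B\<^sup>* S\<^sup>*\<close> with at least one \<open>S\<close> for factors, and all words
  with at least one \<open>S\<close> for subwords. State \<open>0\<close> is initial and \<open>5\<close> is a dead state.
\<close>

definition prefix_ctl :: "nat \<Rightarrow> bool \<Rightarrow> nat" where
  "prefix_ctl c b = (if c = 0 then if b then 0 else 1 else if c = 1 \<and> \<not> b then 1 else 5)"

definition suffix_ctl :: "nat \<Rightarrow> bool \<Rightarrow> nat" where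
  "suffix_ctl c b =
     (if c \<le> 1 \<and> \<not> b then 1 else if (c = 1 \<or> c = 2) \<and> b then 2 else 5)"

text \<open>State \<open>1\<close> has read \<open>B\<^sup>+\<close>, \<open>2\<close> has read
  \<open>S\<^sup>+\<close>, \<open>3\<close> has read \<open>S\<^sup>+ B\<^sup>+\<close>, and
  \<open>4\<close> a word in \<open>B\<^sup>+ S\<^sup>+\<close> or
  \<open>S\<^sup>+ B\<^sup>+ S\<^sup>+\<close>. With \<open>0\<close> and the dead state this
  accounts for the constant 6.\<close>

definition sublist_ctl :: "nat \<Rightarrow> bool \<Rightarrow> nat" where
  "sublist_ctl c b =
     (if c \<le> 1 \<and> b then 1
      else if (c = 0 \<or> c = 2) \<and> \<not> b then 2
      else if (c = 2 \<or> c = 3) \<and> b then 3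
      else if (c = 1 \<or> c = 3 \<or> c = 4) \<and> \<not> b then 4
      else 5)"

definition subseq_ctl :: "nat \<Rightarrow> bool \<Rightarrow> nat" where
  "subseq_ctl c b = (if c = 0 \<and> b then 0 else 1)"

lemma ctl_simps:
  "prefix_ctl 0 True = 0" "prefix_ctl 0 False = 1" "prefix_ctl 1 True = 5" "prefix_ctl 1 False = 1"
  "prefix_ctl 5 b = 5"
  "suffix_ctl 0 True = 5" "suffix_ctl 0 False = 1" "suffix_ctl 1 True = 2" "suffix_ctl 1 False = 1"
  "suffix_ctl 2 True = 2" "suffix_ctl 2 False = 5" "suffix_ctl 5 b = 5"
  "sublist_ctl 0 True = 1" "sublist_ctl 0 False = 2" "sublist_ctl 1 True = 1" "sublist_ctl 1 False = 4"
  "sublist_ctl 2 True = 3" "sublist_ctl 2 False = 2" "sublist_ctl 3 True = 3" "sublist_ctl 3 False = 4"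
  "sublist_ctl 4 True = 5" "sublist_ctl 4 False = 4" "sublist_ctl 5 b = 5"
  "subseq_ctl 0 True = 0" "subseq_ctl 0 False = 1" "subseq_ctl 1 b = 1"
  by (simp_all add: prefix_ctl_def suffix_ctl_def sublist_ctl_def subseq_ctl_def)

text \<open>The states are treated backwards, beginning with the dead one; for each, a known
  relation between \<open>v\<close> and \<open>w\<close> is found that solves the recursion. The
  other three relations follow the same plan.\<close>

lemma aligned_from_prefix:
  "aligned_from prefix_ctl {1} 0 v w \<longleftrightarrow> prefix v w \<and> v \<noteq> w"
proof -
  \<comment> \<open>\<open>One_nat_def\<close> is removed so that state \<open>1\<close> keeps the
    form in which \<open>ctl_simps\<close> mentions it.\<close>
  have dead: "\<not> aligned_from prefix_ctl {1} 5 v w" for v w :: "'a list"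
    by (induction w arbitrary: v) (auto simp del: One_nat_def simp: aligned_from_Nil aligned_from_Cons ctl_simps)
  have one: "aligned_from prefix_ctl {1} 1 v w \<longleftrightarrow> v = []" for v w :: "'a list"
    by (induction w arbitrary: v) (auto simp del: One_nat_def simp: aligned_from_Nil aligned_from_Cons ctl_simps dead)
  show "aligned_from prefix_ctl {1} 0 v w \<longleftrightarrow> prefix v w \<and> v \<noteq> w"
    by (induction w arbitrary: v)
       (auto simp del: One_nat_def simp: aligned_from_Nil aligned_from_Cons ctl_simps prefix_Cons one)
qed

lemma aligned_from_suffix:
  "aligned_from suffix_ctl {1, 2} 0 v w \<longleftrightarrow> suffix v w \<and> v \<noteq> w"
proof -
  have dead: "\<not> aligned_from suffix_ctl {1, 2} 5 v w" for v w :: "'a list"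
    by (induction w arbitrary: v) (auto simp del: One_nat_def simp: aligned_from_Nil aligned_from_Cons ctl_simps)
  have two: "aligned_from suffix_ctl {1, 2} 2 v w \<longleftrightarrow> v = w" for v w :: "'a list"
    by (induction w arbitrary: v) (auto simp del: One_nat_def simp: aligned_from_Nil aligned_from_Cons ctl_simps dead)
  have one: "aligned_from suffix_ctl {1, 2} 1 v w \<longleftrightarrow> suffix v w" for v w :: "'a list"
    by (induction w arbitrary: v)
       (auto simp del: One_nat_def simp: aligned_from_Nil aligned_from_Cons ctl_simps dead two suffix_Cons)
  \<comment> \<open>State \<open>0\<close> is never entered again, so a case split replaces the
    induction; the length bound excludes \<open>suffix (a # w) w\<close>.\<close>
  show ?thesis
    by (cases w) (auto simp del: One_nat_def simp: aligned_from_Nil aligned_from_Cons ctl_simps dead one suffix_Cons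
        dest: suffix_length_le)
qed

lemma aligned_from_sublist:
  "aligned_from sublist_ctl {2, 3, 4} 0 v w \<longleftrightarrow> sublist v w \<and> v \<noteq> w"
proof -
  let ?A = "{2, 3, 4} :: nat set"
  have dead: "\<not> aligned_from sublist_ctl ?A 5 v w" for v w :: "'a list"
    by (induction w arbitrary: v) (auto simp del: One_nat_def simp: aligned_from_Nil aligned_from_Cons ctl_simps)
  have four: "aligned_from sublist_ctl ?A 4 v w \<longleftrightarrow> v = []" for v w :: "'a list"
    by (induction w arbitrary: v) (auto simp del: One_nat_def simp: aligned_from_Nil aligned_from_Cons ctl_simps dead)
  have three: "aligned_from sublist_ctl ?A 3 v w \<longleftrightarrow> prefix v w" for v w :: "'a list"
    by (induction w arbitrary: v)
       (auto simp del: One_nat_def simp: aligned_from_Nil aligned_from_Cons ctl_simps four prefix_Cons)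
  have two: "aligned_from sublist_ctl ?A 2 v w \<longleftrightarrow> sublist v w" for v w :: "'a list"
    by (induction w arbitrary: v)
       (auto simp del: One_nat_def simp: aligned_from_Nil aligned_from_Cons ctl_simps three sublist_Cons_right prefix_Cons)
  \<comment> \<open>If a letter is matched before any skip, the occurrence starts at the beginning
    of the word, so what remains must be a proper prefix.\<close>
  have one: "aligned_from sublist_ctl ?A 1 v w \<longleftrightarrow> prefix v w \<and> v \<noteq> w" for v w :: "'a list"
    by (induction w arbitrary: v)
       (auto simp del: One_nat_def simp: aligned_from_Nil aligned_from_Cons ctl_simps four prefix_Cons)
  show ?thesis
    by (cases w) (auto simp del: One_nat_def simp: aligned_from_Nil aligned_from_Cons ctl_simps one two
        sublist_Cons_right prefix_Cons dest: sublist_length_le)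
qed

lemma aligned_from_subseq:
  "aligned_from subseq_ctl {1} 0 v w \<longleftrightarrow> subseq v w \<and> v \<noteq> w"
proof -
  have one: "aligned_from subseq_ctl {1} 1 v w \<longleftrightarrow> subseq v w" for v w :: "'a list"
  proof (induction w arbitrary: v)
    case (Cons a w)
    then show ?case by (cases v) (auto simp del: One_nat_def simp: aligned_from_Cons ctl_simps dest: subseq_Cons')
  qed (auto simp del: One_nat_def simp: aligned_from_Nil)
  have "aligned_from subseq_ctl {1} 0 v w \<longleftrightarrow> subseq v w \<and> v \<noteq> w"
  proof (induction w arbitrary: v)
    case (Cons a w)
    \<comment> \<open>When both words begin with \<open>a\<close>, this absorbs the alternative of
      skipping that letter into the alternative of matching it.\<close>
    have "v' \<noteq> w \<and> subseq v' w" if "subseq (a # v') w" for v'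
      using list_emb_length[OF that] subseq_Cons'[OF that] by auto
    then show ?case
      using Cons by (cases v) (auto simp del: One_nat_def simp: aligned_from_Cons ctl_simps one)
  qed (auto simp del: One_nat_def simp: aligned_from_Nil)
  then show ?thesis by simp
qed

section \<open>The decision program\<close>

abbreviation (input) rStart :: nat where "rStart \<equiv> 25"

text \<open>All products come from repeated addition: one loop for \<open>n * k\<close> and
  \<open>n * n\<close> together, one for the row addresses \<open>B + p * n\<close>, and
  straight-line code for the multiples of \<open>n * n\<close>.\<close>

definition prepare :: com where
  "prepare = block
    [Const rX 3, Add rTab rX rN, Add rMul rTab rZero, Const rSq 0, Const rP 0,
     WhileLess rP rN (block [Add rMul rMul rK, Add rSq rSq rN, Add rP rP rOne]),
     Add rBase rMul rN, Const rP 0, Add rX rMul rZero, Add rY rBase rZero,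
     WhileLess rP rN (block [Store rX rY, Add rX rX rOne, Add rY rY rN, Add rP rP rOne]),
     Const (rOff 0) 0, Add (rOff 1) (rOff 0) rSq, Add (rOff 2) (rOff 1) rSq,
     Add (rOff 3) (rOff 2) rSq, Add (rOff 4) (rOff 3) rSq, Add (rOff 5) (rOff 4) rSq,
     Add rNodes (rOff 5) rSq, Add rFree rBase rNodes, Add rFree rFree rNodes]"

text \<open>The counter of the start node \<open>node 0 s s\<close> is at
  \<open>B + s * n + s + N\<close>; \<open>s\<close> is read from address 2 and
  \<open>B + s * n\<close> from the row table. The counters are not reset between the two
  closures.\<close>

definition decide_loaded :: "(nat \<Rightarrow> bool \<Rightarrow> nat) \<Rightarrow> nat list \<Rightarrow> com" where
  "decide_loaded ctl accs = block
    [prepare, build ctl accs, Const 0 0, Add rThr rOne rZero, closure,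
     Const rX 2, Load rX rX, Add rY rMul rX, Load rY rY, Add rY rY rX, Add rStart rY rNodes,
     Load rX rStart,
     IfLess rZero rX Skip
       (block [Add rThr rK rK, closure, Load rX rStart, IfLess rZero rX Skip (Add 0 rOne rZero)])]"

text \<open>\<open>rZero\<close> is never assigned and keeps its initial value 0. Over the empty
  alphabet the language has at most one word, hence no witnesses, and register \<open>0\<close> is
  still 0, which is the negative answer.\<close>

definition decide :: "(nat \<Rightarrow> bool \<Rightarrow> nat) \<Rightarrow> nat list \<Rightarrow> com" where
  "decide ctl accs = block
    [Const rOne 1, Load rN rZero, Load rK rOne, IfLess rZero rK (decide_loaded ctl accs) Skip]"

context build_memory
begin

lemma prepare_spec:
  assumes r: "r rZero = 0" "r rOne = 1" "r rN = n" "r rK = k"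
    and m: "\<And>x. x < M \<Longrightarrow> m x = mi x" "\<And>x. M \<le> x \<Longrightarrow> m x = 0"
  shows "wp W prepare (\<lambda>r' m' u'. built [] {} r' m' \<and> u' \<le> u + 21 + 11 * n) r m u"
proof -
  let ?loop1 = "WhileLess rP rN (block [Add rMul rMul rK, Add rSq rSq rN, Add rP rP rOne])"
  let ?loop2 = "WhileLess rP rN (block [Store rX rY, Add rX rX rOne, Add rY rY rN, Add rP rP rOne])"
  let ?post = "\<lambda>r' m' u'. built [] {} r' m' \<and> u' \<le> u + 21 + 11 * n"
  define inv where "inv r' \<longleftrightarrow> r' rZero = 0 \<and> r' rOne = 1 \<and> r' rN = n \<and> r' rK = k \<and> r' rTab = 3 + n"
    for r' :: "nat \<Rightarrow> nat"
  have mult: "i * k + k \<le> n * k" "i * n + n \<le> n * n" if "i < n" for i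
    using mult_le_mono[of "Suc i" n k k] mult_le_mono[of "Suc i" n n n] that by auto
  have loop1: "wp W ?loop1 Q r1 m u1"
    if r1: "inv r1" "r1 rMul = 3 + n" "r1 rSq = 0" "r1 rP = 0"
      and Q: "\<And>r' u'. inv r' \<Longrightarrow> r' rMul = M \<Longrightarrow> r' rSq = n * n \<Longrightarrow> u' \<le> u1 + 1 + 5 * n \<Longrightarrow> Q r' m u'"
    for Q r1 u1
  proof (rule wp_for[where a = 0 and n = n and J = "\<lambda>i r' m' u'. inv r' \<and> m' = m \<and>
      r' rMul = 3 + n + i * k \<and> r' rSq = i * n \<and> r' rP = i \<and> u' \<le> u1 + 5 * i"])
    show "Q r' m' (u' + 1)" if "inv r' \<and> m' = m \<and> r' rMul = 3 + n + n * k \<and> r' rSq = n * n \<and> r' rP = n \<and>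
        u' \<le> u1 + 5 * n" for r' m' u'
      using that Q[of r' "u' + 1"] layout(1) by simp
    fix i r' m' u'
    assume i: "i < n" and J: "inv r' \<and> m' = m \<and> r' rMul = 3 + n + i * k \<and> r' rSq = i * n \<and> r' rP = i \<and>
        u' \<le> u1 + 5 * i"
    have "3 + n + i * k + k \<le> W" "i * n + n \<le> W" "Suc i \<le> W"
      using mult[OF i] i layout by linarith+
    then show "wp W (block [Add rMul rMul rK, Add rSq rSq rN, Add rP rP rOne]) (\<lambda>r' m' u'. inv r' \<and> m' = m \<and>
        r' rMul = 3 + n + Suc i * k \<and> r' rSq = Suc i * n \<and> r' rP = Suc i \<and> u' \<le> u1 + 5 * Suc i) r' m' (u' + 1)"
      using J unfolding inv_def by (simp add: wp_simps)
  qed (use r1 in \<open>auto simp: inv_def\<close>)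
  have loop2: "wp W ?loop2 Q r1 m u1"
    if r1: "inv r1" "r1 rMul = M" "r1 rSq = n * n" "r1 rBase = B" "r1 rP = 0" "r1 rX = M" "r1 rY = B"
      and Q: "\<And>r' m' u'. inv r' \<Longrightarrow> r' rMul = M \<Longrightarrow> r' rSq = n * n \<Longrightarrow> r' rBase = B \<Longrightarrow>
        (\<forall>x<B. m' x = mi x) \<Longrightarrow> (\<forall>x\<ge>B. m' x = 0) \<Longrightarrow> u' \<le> u1 + 1 + 6 * n \<Longrightarrow> Q r' m' u'"
    for Q r1 u1
  proof (rule wp_for[where a = 0 and n = n and J = "\<lambda>i r' m' u'. inv r' \<and> r' rMul = M \<and>
      r' rSq = n * n \<and> r' rBase = B \<and> r' rP = i \<and> r' rX = M + i \<and> r' rY = B + i * n \<and>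
      (\<forall>x<M + i. m' x = mi x) \<and> (\<forall>x\<ge>M + i. m' x = 0) \<and> u' \<le> u1 + 6 * i"])
    show "Q r' m' (u' + 1)" if "inv r' \<and> r' rMul = M \<and>
      r' rSq = n * n \<and> r' rBase = B \<and> r' rP = n \<and> r' rX = M + n \<and> r' rY = B + n * n \<and>
      (\<forall>x<M + n. m' x = mi x) \<and> (\<forall>x\<ge>M + n. m' x = 0) \<and> u' \<le> u1 + 6 * n" for r' m' u'
      using that layout(2) by (intro Q) auto
    fix i r' m' u'
    assume i: "i < n" and J: "inv r' \<and> r' rMul = M \<and>
      r' rSq = n * n \<and> r' rBase = B \<and> r' rP = i \<and> r' rX = M + i \<and> r' rY = B + i * n \<and>
      (\<forall>x<M + i. m' x = mi x) \<and> (\<forall>x\<ge>M + i. m' x = 0) \<and> u' \<le> u1 + 6 * i"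
    have "M + i + 1 \<le> W" "B + i * n + n \<le> W" "Suc i \<le> W"
      using mult[OF i] i layout by linarith+
    moreover have "(m'(M + i := B + i * n)) x = mi x" if "x < M + Suc i" for x
      using that J mul_table[OF i] by (auto simp: less_Suc_eq)
    ultimately show "wp W (block [Store rX rY, Add rX rX rOne, Add rY rY rN, Add rP rP rOne])
      (\<lambda>r' m' u'. inv r' \<and> r' rMul = M \<and>
      r' rSq = n * n \<and> r' rBase = B \<and> r' rP = Suc i \<and> r' rX = M + Suc i \<and> r' rY = B + Suc i * n \<and>
      (\<forall>x<M + Suc i. m' x = mi x) \<and> (\<forall>x\<ge>M + Suc i. m' x = 0) \<and> u' \<le> u1 + 6 * Suc i) r' m' (u' + 1)"
      using J unfolding inv_def by (simp add: wp_simps)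
  qed (use r1 m in \<open>auto simp: inv_def\<close>)
  have small: "3 + n \<le> W" "M \<le> W" "B \<le> W" "N \<le> W" "B + N \<le> W" "B + N + N \<le> W"
    using layout by linarith+
  have tail: "wp W (block [Const (rOff 0) 0, Add (rOff 1) (rOff 0) rSq, Add (rOff 2) (rOff 1) rSq,
     Add (rOff 3) (rOff 2) rSq, Add (rOff 4) (rOff 3) rSq, Add (rOff 5) (rOff 4) rSq,
     Add rNodes (rOff 5) rSq, Add rFree rBase rNodes, Add rFree rFree rNodes]) ?post r' m' u'"
    if "inv r'" "r' rMul = M" "r' rSq = n * n" "r' rBase = B"
      "\<forall>x<B. m' x = mi x" "\<forall>x\<ge>B. m' x = 0" "u' \<le> u + 11 + 11 * n" for r' m' u'
  proof -
    have "c < 6 \<longleftrightarrow> c = 0 \<or> c = 1 \<or> c = 2 \<or> c = 3 \<or> c = 4 \<or> c = 5" for c :: nat by arith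
    then have six: "(\<forall>c<6. P c) \<longleftrightarrow> P 0 \<and> P 1 \<and> P 2 \<and> P 3 \<and> P 4 \<and> P (5::nat)" for P
      by simp blast
    have "built [] {} r'' m'" if "fixed_regs r''" "r'' rFree = H" for r''
      using that \<open>\<forall>x<B. m' x = mi x\<close> \<open>\<forall>x\<ge>B. m' x = 0\<close> unfolding built_def by (auto simp: sources_def)
    moreover have "6 * (n * n) = N" "H = B + N + N" using layout(3,4) by auto
    ultimately show ?thesis
      using that small unfolding inv_def
      by (simp add: wp_simps) (simp add: fixed_regs_def six)
  qed
  show ?thesis
    unfolding prepare_def
    apply (simp only: wp_block_Cons[of _ "Const rX _"] wp_block_Cons[of _ "Const rP _"] wp_block_Cons[of _ "Const rSq _"]
       wp_block_Cons_eq[of _ "WhileLess _ _ _"] wp_block_Cons[of _ "Add rTab _ _"] wp_block_Cons[of _ "Add rMul _ _"] wp_Const wp_Add)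
    apply (intro conjI)
    subgoal using small by simp
    subgoal using small r by simp
    subgoal using small r by simp
    subgoal by simp
    subgoal by simp
    subgoal
      apply (rule loop1)
      apply (use r in \<open>auto simp: inv_def\<close>)[4]
      apply (simp only: wp_block_Cons[of _ "Add rBase _ _"] wp_block_Cons[of _ "Const rP _"] wp_block_Cons[of _ "Add rX _ _"]
         wp_block_Cons[of _ "Add rY _ _"] wp_block_Cons_eq[of _ "WhileLess _ _ _"] wp_Const wp_Add)
      apply (intro conjI)
      subgoal using small layout(2) unfolding inv_def by simp
      subgoal by simp
      subgoal using small unfolding inv_def by simp
      subgoal using small layout(2) unfolding inv_def by simp
      subgoal
        apply (rule loop2)
        apply (use layout(2) in \<open>auto simp: inv_def\<close>)[7]
        apply (rule tail)
        apply auto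
        done
      done
    done
qed

end

context build_memory
begin

lemma built_marked:
  assumes "built es A r m" "A \<subseteq> V"
  shows "{v \<in> V. 0 < m (v + N)} = A"
proof -
  have "0 < m (v + N) \<longleftrightarrow> v \<in> A" if "v \<in> V" for v
    using assms(1) that unfolding built_def by simp
  then show ?thesis using assms(2) by blast
qed

text \<open>What a closure run preserves. Counters and the words from \<open>H + 2 * E\<close> on
  are left free, so a second run can start on the counters of the first and overwrite its
  queue.\<close>

definition graph_state :: "(nat \<Rightarrow> nat) \<Rightarrow> (nat \<Rightarrow> nat) \<Rightarrow> bool" where
  "graph_state r m \<longleftrightarrow> fixed_regs r \<and> r rFree = H + 2 * E \<and> (\<forall>x<B. m x = mi x) \<and>
     (\<forall>v\<in>V. chain H (H + 2 * E) m (m v) (sources all_edges v))"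

lemma closure_graph_spec:
  assumes g: "graph_state r m" and T: "0 < r rThr"
  shows "wp W closure (\<lambda>r' m' u'. graph_state r' m' \<and> same_regs r r' \<and>
     (\<exists>S. least_threshold_closed (sources all_edges) V (r rThr) {v \<in> V. 0 < m (v + N)} S \<and>
        (\<forall>v\<in>V. m' (v + N) = 0 \<longleftrightarrow> v \<in> S)) \<and>
     u' \<le> u + 8 + 16 * N + 15 * E) r m u"
proof -
  have gm: "graph_memory W B N H (H + 2 * E) (r rThr) (sources all_edges) r m"
  proof
    have "fst e \<in> V" if "e \<in> set all_edges" for e
    proof -
      obtain c p q b a where "e = (node c p q, step c p q b a)" "c < 6" "p < n" "q < n"
        using \<open>e \<in> set all_edges\<close> unfolding set_all_edges by blast
      then show ?thesis using node_in by simp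
    qed
    then show "set (sources all_edges v) \<subseteq> V" for v
      unfolding sources_def by auto
  qed (use g[unfolded graph_state_def fixed_regs_def] T layout(4,6) in auto)
  have bound: "(\<Sum>v\<in>V. length (sources all_edges v)) \<le> E"
    using sum_length_sources[of V all_edges] length_all_edges by simp
  show ?thesis
  proof (rule wp_conseq[OF graph_memory.closure_spec[OF gm]], elim conjE)
    fix r' m' u'
    assume regs: "same_regs r r'"
      and mem: "\<forall>x<H + 2 * E. x \<notin> {B + N..<B + 2 * N} \<longrightarrow> m' x = m x"
      and S: "\<exists>S. least_threshold_closed (sources all_edges) V (r rThr) (graph_memory.X B N m) S \<and>
        (\<forall>v\<in>V. m' (v + N) = 0 \<longleftrightarrow> v \<in> S)"
      and t: "u' \<le> u + 8 + 16 * N + 15 * (\<Sum>v\<in>V. length (sources all_edges v))"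
    have "graph_state r' m'"
      unfolding graph_state_def
    proof (intro conjI ballI allI impI)
      show "fixed_regs r'" "r' rFree = H + 2 * E"
        using g regs unfolding graph_state_def fixed_regs_def same_regs_def by auto
      show "m' x = mi x" if "x < B" for x
        using that mem g layout(4) unfolding graph_state_def by auto
      fix v assume v: "v \<in> V"
      have "m' v = m v" using v mem layout(4) by auto
      moreover have "chain H (H + 2 * E) m (m v) (sources all_edges v)"
        using g v unfolding graph_state_def by blast
      ultimately show "chain H (H + 2 * E) m' (m' v) (sources all_edges v)"
        using mem layout(4) by (auto intro: chain_cong[where m = m and hi = "H + 2 * E"])
    qed
    moreover have "u' \<le> u + 8 + 16 * N + 15 * E" using t bound by linarith
    ultimately show "graph_state r' m' \<and> same_regs r r' \<and>
     (\<exists>S. least_threshold_closed (sources all_edges) V (r rThr) {v \<in> V. 0 < m (v + N)} S \<and>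
        (\<forall>v\<in>V. m' (v + N) = 0 \<longleftrightarrow> v \<in> S)) \<and> u' \<le> u + 8 + 16 * N + 15 * E"
      using regs S unfolding graph_memory.X_def[OF gm] by blast
  qed
qed

lemma decide_loaded_spec:
  assumes R: "\<And>v w. R v w \<and> v \<noteq> w \<longleftrightarrow> aligned_from ctl (set accs) 0 v w"
    and L: "L = {w \<in> lists {..<k}. foldl \<delta> s w \<in> Acc}"
    and k: "0 < k" and s: "s < n" "mi 2 = s"
    and r: "r rZero = 0" "r rOne = 1" "r rN = n" "r rK = k"
    and m: "\<And>x. x < M \<Longrightarrow> m x = mi x" "\<And>x. M \<le> x \<Longrightarrow> m x = 0"
  shows "wp W (decide_loaded ctl accs) (\<lambda>r' m' u'. r' 0 = (if almost_free R L then 1 else 0) \<and>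
     u' \<le> u + 62 + 11 * n + n * (11 + n * (36 + k * 132)) + 32 * N + 30 * E) r m u"
proof -
  define post where "post r' m' u' \<longleftrightarrow> r' 0 = (if almost_free R L then 1 else 0) \<and>
     u' \<le> u + 62 + 11 * n + n * (11 + n * (36 + k * 132)) + 32 * N + 30 * E"
    for r' m' :: "nat \<Rightarrow> nat" and u'
  \<comment> \<open>The time at which \<open>prepare\<close> and \<open>build\<close> are
    finished.\<close>
  let ?t = "u + 28 + 11 * n + n * (11 + n * (36 + k * 132))"
  let ?v = "node 0 s s"
  let ?A = "\<Union>p<n. \<Union>q<n. marks p q"
  have v: "?v \<in> V" using s by (intro node_in) auto
  have kW: "k + k \<le> W"
  proof -
    have "k + k \<le> E" using s unfolding layout(5) by (cases n) auto
    then show ?thesis using layout(6) by linarith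
  qed
  have vW: "?v + N \<le> W" using v layout(4,6) by auto
  have second: "wp W (block [Add rThr rK rK, closure, Load rX rStart, IfLess rZero rX Skip (Add 0 rOne rZero)])
      (wp W (block []) post) r1 m1 u1"
    if g: "graph_state r1 m1" and r0: "r1 0 = 0" "r1 rStart = ?v + N"
      and S1: "least_threshold_closed (sources all_edges) V 1 ?A S1" "\<And>v. v \<in> V \<Longrightarrow> m1 (v + N) = 0 \<longleftrightarrow> v \<in> S1"
      and vS1: "?v \<in> S1" and u1: "u1 \<le> ?t + 8 + 16 * N + 15 * E + 12" for r1 m1 u1 S1
  proof -
    have rk: "r1 rK = k" using g unfolding graph_state_def fixed_regs_def by auto
    let ?r = "r1(rThr := k + k)"
    have g': "graph_state ?r m1" using g unfolding graph_state_def fixed_regs_def by auto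
    have X: "{v \<in> V. 0 < m1 (v + N)} = V - S1"
      using S1(2) by (intro set_eqI) (metis (mono_tags, lifting) Diff_iff gr0I mem_Collect_eq nat_less_le)
    have "wp W closure (wp W (block [Load rX rStart, IfLess rZero rX Skip (Add 0 rOne rZero)])
      (wp W (block []) post)) ?r m1 (u1 + 1)"
    proof (rule wp_conseq[OF closure_graph_spec[OF g']], use k in simp, elim conjE exE)
      fix r2 m2 u2 S
      assume g2: "graph_state r2 m2" and sr: "same_regs ?r r2"
        and S: "least_threshold_closed (sources all_edges) V (?r rThr) {v \<in> V. 0 < m1 (v + N)} S"
          "\<forall>v\<in>V. m2 (v + N) = 0 \<longleftrightarrow> v \<in> S"
        and u2: "u2 \<le> u1 + 1 + 8 + 16 * N + 15 * E"
      have "least_threshold_closed (sources all_edges) V (2 * k) (V - S1) S"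
        using S(1) unfolding X by (simp add: mult_2)
      then have fin: "?v \<in> S \<longleftrightarrow> finite {z. accepts 0 s s z}"
        using finite_iff[OF nonempty_iff[OF S1(1)]] s by auto
      have "almost_free R L \<longleftrightarrow> ?v \<in> S"
        using almost_free_iff[OF R L] nonempty_iff[OF S1(1), of 0 s s] vS1 fin s by auto
      also have "\<dots> \<longleftrightarrow> m2 (?v + N) = 0" using S(2) v by blast
      finally have ans: "almost_free R L \<longleftrightarrow> m2 (?v + N) = 0" .
      have rr: "r2 rZero = 0" "r2 rOne = 1" using g2 unfolding graph_state_def fixed_regs_def by auto
      have "r2 0 = 0" "r2 rStart = ?v + N" using sr r0 unfolding same_regs_def by auto
      moreover have "1 \<le> W" using k kW by linarith
      ultimately show "wp W (block [Load rX rStart, IfLess rZero rX Skip (Add 0 rOne rZero)])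
        (wp W (block []) post) r2 m2 u2"
        using u2 u1 rr by (simp add: wp_simps ans post_def)
    qed
    then show ?thesis using kW by (simp add: wp_block_Cons_eq[of _ "Add _ _ _"] wp_block_Cons_eq[of _ closure] wp_Add rk)
  qed
  have first: "wp W (block [Const rX 2, Load rX rX, Add rY rMul rX, Load rY rY, Add rY rY rX, Add rStart rY rNodes,
     Load rX rStart, IfLess rZero rX Skip
       (block [Add rThr rK rK, closure, Load rX rStart, IfLess rZero rX Skip (Add 0 rOne rZero)])]) post r1 m1 u1"
    if g: "graph_state r1 m1" and r0: "r1 0 = 0"
      and S: "least_threshold_closed (sources all_edges) V 1 ?A S" "\<And>v. v \<in> V \<Longrightarrow> m1 (v + N) = 0 \<longleftrightarrow> v \<in> S"
      and u1: "u1 \<le> ?t + 2 + 8 + 16 * N + 15 * E" for r1 m1 u1 S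
  proof -
    have rr: "r1 rZero = 0" "r1 rMul = M" "r1 rNodes = N"
      and m1: "\<And>x. x < B \<Longrightarrow> m1 x = mi x"
      using g unfolding graph_state_def fixed_regs_def by auto
    have "2 < B" "M + s < B" using layout(1,2) s by auto
    then have mem: "m1 2 = s" "m1 (M + s) = B + s * n" using m1 s mul_table by auto
    have bounds: "2 \<le> W" "M + s \<le> W" "B + s * n + s \<le> W" "B + s * n + s + N \<le> W"
      using \<open>2 < B\<close> \<open>M + s < B\<close> vW unfolding node_def by auto
    have node: "B + s * n + s + N = ?v + N" unfolding node_def by simp
    show ?thesis
    proof (cases "?v \<in> S")
      case True
      then have z: "m1 (B + s * n + s + N) = 0" using S(2) v unfolding node by blast
      have "graph_state r' m1" if "keep {rX, rY, rStart} r1 r'" for r'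
        using g that unfolding graph_state_def fixed_regs_def keep_def by auto
      then have "wp W (block [Add rThr rK rK, closure, Load rX rStart, IfLess rZero rX Skip (Add 0 rOne rZero)])
        (wp W (block []) post) r' m1 u'"
        if "keep {rX, rY, rStart} r1 r'" "r' rStart = B + s * n + s + N" "u' \<le> u1 + 8" for r' u'
        by (rule second[OF _ _ _ S True]) (use that r0 u1 node in \<open>auto simp: keep_def\<close>)
      then show ?thesis
        using bounds
        by (simp add: wp_block_Cons_eq[of _ "Const _ _"] wp_block_Cons_eq[of _ "Load rY _"]
            wp_block_Cons_eq[of _ "Load rX _"] wp_block_Cons_eq[of _ "Add rY _ _"]
            wp_block_Cons_eq[of _ "Add rStart _ _"]
            wp_block_Cons_eq[of _ "IfLess _ _ _ _"] wp_Const wp_Load wp_Add wp_If rr mem z keep_def)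
    next
      case False
      then have z: "0 < m1 (B + s * n + s + N)" using S(2) v unfolding node by auto
      have "\<not> almost_free R L"
        using almost_free_iff[OF R L] nonempty_iff[OF S(1), of 0 s s] False s by auto
      then show ?thesis
        using bounds z r0 u1 by (simp add: wp_simps rr mem post_def)
    qed
  qed
  have "wp W (decide_loaded ctl accs) post r m u"
    unfolding decide_loaded_def wp_block_Cons_eq[of _ prepare] wp_block_Cons_eq[of _ "build _ _"]
  proof (rule wp_conseq[OF prepare_spec[OF r m]], simp, simp, elim conjE, rule wp_conseq[OF build_spec], assumption, elim conjE)
    fix r1 m1 u1 r2 m2 u2
    assume u1: "u1 \<le> u + 21 + 11 * n" and b: "built all_edges ?A r2 m2"
      and u2: "u2 \<le> u1 + 7 + n * (11 + n * (36 + k * 132))"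
    let ?r = "r2(0 := 0, rThr := 1)"
    have g: "graph_state ?r m2"
      using b unfolding built_def graph_state_def fixed_regs_def length_all_edges by auto
    have X: "{v \<in> V. 0 < m2 (v + N)} = ?A"
    proof -
      have "?A \<subseteq> V" using node_in accs(1) unfolding marks_def by (auto split: if_splits)
      then show ?thesis by (rule built_marked[OF b])
    qed
    have "wp W closure (wp W (block [Const rX 2, Load rX rX, Add rY rMul rX, Load rY rY, Add rY rY rX, Add rStart rY rNodes,
     Load rX rStart, IfLess rZero rX Skip
       (block [Add rThr rK rK, closure, Load rX rStart, IfLess rZero rX Skip (Add 0 rOne rZero)])]) post)
       ?r m2 (u2 + 2)"
    proof (rule wp_conseq[OF closure_graph_spec[OF g]], simp, elim conjE exE)
      fix r3 m3 u3 S
      assume g3: "graph_state r3 m3" and sr: "same_regs ?r r3"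
        and S: "least_threshold_closed (sources all_edges) V (?r rThr) {v \<in> V. 0 < m2 (v + N)} S"
          "\<forall>v\<in>V. m3 (v + N) = 0 \<longleftrightarrow> v \<in> S"
        and u3: "u3 \<le> u2 + 2 + 8 + 16 * N + 15 * E"
      show "wp W (block [Const rX 2, Load rX rX, Add rY rMul rX, Load rY rY, Add rY rY rX, Add rStart rY rNodes,
       Load rX rStart, IfLess rZero rX Skip
       (block [Add rThr rK rK, closure, Load rX rStart, IfLess rZero rX Skip (Add 0 rOne rZero)])]) post r3 m3 u3"
      proof (rule first[OF g3, where S = S])
        show "r3 0 = 0" using sr unfolding same_regs_def by auto
        show "least_threshold_closed (sources all_edges) V 1 ?A S" using S(1) unfolding X by simp
      qed (use S(2) u1 u2 u3 in auto)
    qed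
    moreover have "r2 rOne = 1" "r2 rZero = 0" "1 \<le> W"
      using built_regs[OF b] k kW by auto
    ultimately show "wp W (block [Const 0 0, Add rThr rOne rZero, closure,
     Const rX 2, Load rX rX, Add rY rMul rX, Load rY rY, Add rY rY rX, Add rStart rY rNodes,
     Load rX rStart,
     IfLess rZero rX Skip
       (block [Add rThr rK rK, closure, Load rX rStart, IfLess rZero rX Skip (Add 0 rOne rZero)])]) post r2 m2 u2"
      by (simp add: wp_block_Cons[of _ "Const 0 0"] wp_block_Cons_eq[of _ "Add rThr _ _"] wp_block_Cons_eq[of _ closure] wp_Const wp_Add)
  qed
  then show ?thesis by (rule wp_conseq) (simp add: post_def)
qed

end

section \<open>The encoded input and the final estimate\<close>

lemma nth_concat_rows:
  assumes "q < n" "a < k"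
  shows "concat (map (\<lambda>q. map (f q) [0..<k]) [0..<n]) ! (q * k + a) = f q a"
  using assms
proof (induction n)
  case (Suc n)
  have len: "length (concat (map (\<lambda>q. map (f q) [0..<k]) [0..<n])) = n * k"
    by (simp add: length_concat comp_def sum_list_triv)
  show ?case
  proof (cases "q < n")
    case True
    have "q * k + a < Suc q * k" using Suc.prems by simp
    also have "\<dots> \<le> n * k" using True by (intro mult_le_mono) auto
    finally show ?thesis using Suc True by (simp add: nth_append len)
  next
    case False
    then have "q = n" using Suc.prems by simp
    then show ?thesis using Suc.prems by (simp add: nth_append len)
  qed
qed simp

lemma encode_dfa_length: "length (encode_dfa M) = 3 + num_states M + num_states M * num_letters M"
  unfolding encode_dfa_def by (simp add: length_concat comp_def sum_list_triv)

lemma encode_dfa_nth: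
  "encode_dfa M ! 0 = num_states M" "encode_dfa M ! 1 = num_letters M" "encode_dfa M ! 2 = start M"
  "q < num_states M \<Longrightarrow> encode_dfa M ! (3 + q) = (if q \<in> accepting M then 1 else 0)"
  "q < num_states M \<Longrightarrow> a < num_letters M \<Longrightarrow>
     encode_dfa M ! (3 + num_states M + q * num_letters M + a) = trans M q a"
proof -
  let ?acc = "[if q \<in> accepting M then 1 else 0. q \<leftarrow> [0..<num_states M]] :: nat list"
  let ?tab = "concat (map (\<lambda>q. map (trans M q) [0..<num_letters M]) [0..<num_states M])"
  have e: "encode_dfa M = [num_states M, num_letters M, start M] @ ?acc @ ?tab"
    unfolding encode_dfa_def by simp
  show "encode_dfa M ! 0 = num_states M" "encode_dfa M ! 1 = num_letters M" "encode_dfa M ! 2 = start M"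
    unfolding e by simp_all
  show "encode_dfa M ! (3 + q) = (if q \<in> accepting M then 1 else 0)" if "q < num_states M"
    using that unfolding e by (simp add: nth_append)
  show "encode_dfa M ! (3 + num_states M + q * num_letters M + a) = trans M q a"
    if "q < num_states M" "a < num_letters M"
  proof -
    have "encode_dfa M ! (3 + num_states M + q * num_letters M + a) = ?tab ! (q * num_letters M + a)"
      unfolding e by (simp add: nth_append)
    then show ?thesis using nth_concat_rows[OF that] by simp
  qed
qed

lemma decidable_aligned:
  fixes R :: "nat list \<Rightarrow> nat list \<Rightarrow> bool"
  assumes R: "\<And>v w. R v w \<and> v \<noteq> w \<longleftrightarrow> aligned_from ctl (set accs) 0 v w"
    and ctl: "\<And>c b. c < 6 \<Longrightarrow> ctl c b < 6" and accs: "set accs \<subseteq> {..<6}" "length accs \<le> 6"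
  shows "decidable_in_quadratic_time (\<lambda>M. almost_free R (dfa_lang M))"
  unfolding decidable_in_quadratic_time_def
\<comment> \<open>The factor \<open>c\<close> stays schematic until the last \<open>show\<close>
  fixes it as \<open>1000 * (k + 1)\<close>. The exponent is 2 because for fixed \<open>k\<close>
  all addresses are O(n^2).\<close>
proof (intro exI[of _ "decide ctl accs"] allI, rule exI, rule exI[of _ 2], intro allI impI, elim conjE)
  fix k M
  assume wf: "wf_dfa M" and k: "num_letters M = k"
  define n where "n = num_states M"
  \<comment> \<open>\<open>C\<close> bounds both the time and the numbers in words. The constant is
    generous: as \<open>1 \<le> n\<close>, the time is at most 317 n^2 + 492 k n^2.\<close>
  define C where "C = 1000 * (k + 1) * n ^ 2"
  define s where "s = start M"
  have s: "s < n" and tr: "\<And>q a. q < n \<Longrightarrow> a < k \<Longrightarrow> trans M q a < n"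
    using wf k unfolding wf_dfa_def n_def s_def by auto
  have n: "n \<le> n * n" "1 \<le> n" using s by (auto simp: le_square)
  have C: "C = 1000 * (n * n) + 1000 * (k * (n * n))"
    unfolding C_def by (simp add: power2_eq_square algebra_simps)
  have nk: "n * k \<le> k * (n * n)" using n by (simp add: mult.commute)
  define m where "m = snd (initial_config (encode_dfa M))"
  have m_lt: "m x = encode_dfa M ! x" if "x < 3 + n + n * k" for x
    using that unfolding m_def initial_config_def n_def k[symmetric] by (simp add: encode_dfa_length)
  have m_ge: "m x = 0" if "3 + n + n * k \<le> x" for x
    using that unfolding m_def initial_config_def n_def k[symmetric] by (simp add: encode_dfa_length)
  have m012: "m 0 = n" "m 1 = k" "m 2 = s"
    using m_lt[of 0] m_lt[of 1] m_lt[of 2] encode_dfa_nth(1-3)[of M] k unfolding n_def s_def by simp_all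
  have L: "dfa_lang M = {w \<in> lists {..<k}. foldl (trans M) s w \<in> accepting M}"
    unfolding dfa_lang_def k s_def ..
  let ?r = "(\<lambda>_. 0)(rOne := 1, rN := n, rK := k) :: nat \<Rightarrow> nat"
  \<comment> \<open>The clock starts at 4, for three assignments and the test of
    \<open>decide\<close>; \<open>u + 1\<close> leaves room for the \<open>Skip\<close> that closes
    its block.\<close>
  have main: "wp C (if 0 < k then decide_loaded ctl accs else Skip)
    (\<lambda>r m u. r 0 = (if almost_free R (dfa_lang M) then 1 else 0) \<and> u + 1 \<le> C) ?r m 4"
  proof (cases "0 < k")
    case True
    let ?B = "3 + n + n * k + n"
    let ?N = "6 * (n * n)"
    let ?E = "n * (n * (k * 12))"
    \<comment> \<open>\<open>mi\<close> anticipates the row table that \<open>prepare\<close> will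
      write; in \<open>m\<close> these words are still 0.\<close>
    define mi where "mi x = (if x < 3 + n + n * k then m x else ?B + (x - (3 + n + n * k)) * n)" for x
    interpret build_memory C n k "3 + n + n * k" ?B ?N "?B + 2 * ?N" ?E ctl accs "trans M" "accepting M" mi
    proof
      have "?E = 12 * (k * (n * n))" by (simp add: algebra_simps)
      then show "?B + 2 * ?N + 2 * ?E + ?N \<le> C" using n nk unfolding C by linarith
      show "mi (3 + q) = (if q \<in> accepting M then 1 else 0)" if "q < n" for q
        using that m_lt[of "3 + q"] encode_dfa_nth(4)[of q M] unfolding mi_def n_def by simp
      show "mi (3 + n + q * k + a) = trans M q a" if "q < n" "a < k" for q a
      proof -
        have "q * k + a < Suc q * k" using that by simp
        also have "\<dots> \<le> n * k" using that by (intro mult_le_mono) auto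
        finally show ?thesis
          using that m_lt[of "3 + n + q * k + a"] encode_dfa_nth(5)[of q M a] k unfolding mi_def n_def by simp
      qed
    qed (use ctl accs tr in \<open>auto simp: mi_def\<close>)
    have "wp C (decide_loaded ctl accs) (\<lambda>r' m' u'. r' 0 = (if almost_free R (dfa_lang M) then 1 else 0) \<and>
       u' \<le> 4 + 62 + 11 * n + n * (11 + n * (36 + k * 132)) + 32 * ?N + 30 * ?E) ?r m 4"
      by (rule decide_loaded_spec[OF R L True s]) (use m012 m_ge in \<open>auto simp: mi_def\<close>)
    then have "wp C (decide_loaded ctl accs)
      (\<lambda>r m u. r 0 = (if almost_free R (dfa_lang M) then 1 else 0) \<and> u + 1 \<le> C) ?r m 4"
    proof (rule wp_conseq)
      fix r' m' :: "nat \<Rightarrow> nat" and u'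
      assume *: "r' 0 = (if almost_free R (dfa_lang M) then 1 else 0) \<and>
        u' \<le> 4 + 62 + 11 * n + n * (11 + n * (36 + k * 132)) + 32 * ?N + 30 * ?E"
      moreover have "n * (11 + n * (36 + k * 132)) = 11 * n + 36 * (n * n) + 132 * (k * (n * n))"
        "?E = 12 * (k * (n * n))" by (simp_all add: algebra_simps)
      ultimately show "r' 0 = (if almost_free R (dfa_lang M) then 1 else 0) \<and> u' + 1 \<le> C"
        using n unfolding C by linarith
    qed
    then show ?thesis using True by simp
  next
    case False
    have "v = [] \<and> w = []" if "v \<in> dfa_lang M" "w \<in> dfa_lang M" for v w
      using that False unfolding L by (auto elim: lists.cases)
    then have "witnesses R (dfa_lang M) = {}" unfolding witnesses_def by auto
    then have "\<not> almost_free R (dfa_lang M)" unfolding almost_free_def by simp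
    moreover have "6 \<le> C" using n unfolding C by linarith
    ultimately show ?thesis using False by (simp add: wp_Skip)
  qed
  define post where "post r m' u \<longleftrightarrow> r 0 = (if almost_free R (dfa_lang M) then 1 else 0) \<and> u \<le> C"
    for r m' :: "nat \<Rightarrow> nat" and u
  have "wp C (if 0 < k then decide_loaded ctl accs else Skip) (wp C (block []) post) ?r m 4"
    by (rule wp_conseq[OF main]) (simp add: post_def wp_block_Nil)
  then have "wp C (if 0 < k then decide_loaded ctl accs else Skip) (wp C (block []) post) ?r m
      (Suc (Suc (Suc (Suc 0))))"
    by (simp add: eval_nat_numeral)
  moreover have "1 \<le> C" using n unfolding C by linarith
  moreover have "m (Suc 0) = k" using m012 by simp
  ultimately have "wp C (decide ctl accs) post (\<lambda>_. 0) m 0"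
    unfolding decide_def
    by (cases "0 < k") (simp_all add: wp_block_Cons_eq[of _ "Const _ _"] wp_block_Cons_eq[of _ "Load _ _"]
      wp_block_Cons_eq[of _ "IfLess _ _ _ _"] wp_Const wp_Load wp_If m012)
  then obtain t r' m' where run: "exec C (decide ctl accs) (initial_config (encode_dfa M)) t (r', m')"
      and post: "post r' m' t"
    unfolding wp_def m_def initial_config_def by auto
  then show "answers_within (1000 * (k + 1) * num_states M ^ 2) (decide ctl accs) (encode_dfa M)
      (1000 * (k + 1) * (num_states M)\<^sup>2) (almost_free R (dfa_lang M))"
    unfolding answers_within_def n_def[symmetric] C_def[symmetric] using post
    by (intro exI[of _ t] exI[of _ "(r', m')"]) (auto simp: post_def)
qed

theorem theorem6:
  shows "decidable_in_quadratic_time (\<lambda>M. almost_free prefix (dfa_lang M)) \<and>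
         decidable_in_quadratic_time (\<lambda>M. almost_free suffix (dfa_lang M)) \<and>
         decidable_in_quadratic_time (\<lambda>M. almost_free sublist (dfa_lang M)) \<and>
         decidable_in_quadratic_time (\<lambda>M. almost_free subseq (dfa_lang M))"
proof (intro conjI)
  show "decidable_in_quadratic_time (\<lambda>M. almost_free prefix (dfa_lang M))"
    \<comment> \<open>\<open>[simplified]\<close> brings the state \<open>1\<close> into the form
      \<open>Suc 0\<close> that it takes in the simplified goal.\<close>
    by (rule decidable_aligned[where ctl = prefix_ctl and accs = "[1]"])
       (simp_all add: aligned_from_prefix[simplified] prefix_ctl_def)
  show "decidable_in_quadratic_time (\<lambda>M. almost_free suffix (dfa_lang M))"
    by (rule decidable_aligned[where ctl = suffix_ctl and accs = "[1, 2]"])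
       (simp_all add: aligned_from_suffix[simplified] suffix_ctl_def)
  show "decidable_in_quadratic_time (\<lambda>M. almost_free sublist (dfa_lang M))"
    by (rule decidable_aligned[where ctl = sublist_ctl and accs = "[2, 3, 4]"])
       (simp_all add: aligned_from_sublist sublist_ctl_def)
  show "decidable_in_quadratic_time (\<lambda>M. almost_free subseq (dfa_lang M))"
    by (rule decidable_aligned[where ctl = subseq_ctl and accs = "[1]"])
       (simp_all add: aligned_from_subseq[simplified] subseq_ctl_def)
qed

end
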